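(* Let $\mathcal S(\varphi,\psi)=(\varphi+F(\varphi,\psi),A_0\psi)$ satisfy Hypotheses 1, 2, 3 stated in the context, let $W\in\mathfrak B^*_{\alpha_-,\alpha_+}(\mathbb T^2,\mathbb R)$, $\alpha_\pm\in(0,\alpha_0]$, describe its invariant manifold, and let $\alpha_*\in(0,\min\{\alpha_-,\alpha_+\}]$ be an exponent for which the conjugation $\mathcal H$ of $\mathcal S$ to its linearization around the invariant manifold (see context) belongs to $\mathscr B_{\alpha_*,2}(\Omega,\mathbb R)$. For any $\lambda_*>0$ with $\lambda_*^{-1}>\max\{\lambda^{-\alpha_*},1-\Gamma\}$ there is a constant $C_1$ (for the given system) depending only on $\lambda_*$ such that, for any observables $\mathcal O_1,\mathcal O_2\in\mathscr B_{\alpha_*,1}(\Omega,\mathbb R)$ and all $n\in\mathbb N$, $$\bigl|\nu_0(\mathcal O_1\,\mathcal O_2\circ\mathcal S^n)-\nu_0(\mathcal O_1)\,\nu_W(\mathcal O_2)\bigr|\le C_1\,\|\mathcal O_1\|_{\alpha_*}\,|||\mathcal O_2|||_{\alpha_*,1}\,\lambda_*^{-n}.$$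
   Context: $\mathbb T=\mathbb R/2\pi\mathbb Z$. $A_0$ is an Anosov (hyperbolic linear) automorphism of $\mathbb T^2$, with eigenvalues $\lambda_\pm$, $|\lambda_+|>1>|\lambda_-|$, $|\lambda_+\lambda_-|=1$, unit eigenvectors $v_\pm$, and $\lambda=|\lambda_+|$. $m_0(d\psi)=d\psi/(2\pi)^2$. For $g:\mathbb T^2\to\mathbb R$, $|g|_\alpha^\pm=\sup_{\psi}\sup_{x\ne0}|g(\psi+xv_\pm)-g(\psi)|/|x|^\alpha$; $\mathfrak B^*_{\alpha_-,\alpha_+}(\mathbb T^2,\mathbb R)$ is the space of bounded continuous $g$ with $\|g\|_\infty+\alpha_-|g|^-_{\alpha_-}+\alpha_+|g|^+_{\alpha_+}<\infty$. For $g$ on $\Omega$, $|g|_\alpha=\sup|g(\varphi,\psi')-g(\varphi,\psi)|/|\psi'-\psi|^\alpha$, $\|g\|_\alpha=\|g\|_\infty+\alpha|g|_\alpha$; for $k\ge1$, $\mathscr B_{\alpha,k}(\Omega,\mathbb R)$ is the space of functions $k$ times continuously differentiable in $\varphi$ with $|||g|||_{\alpha,k}=\sum_{n=0}^k\|\partial_\varphi^ng\|_\infty+\alpha\sum_{n=0}^{k-1}|\partial^n_\varphi g|_\alpha<\infty$ (same definition on $\mathbb T\times\mathbb T^2$). $F\in\mathscr B_{\alpha_0,6}(\mathbb T\times\mathbb T^2,\mathbb R)$ for some $\alpha_0\in(0,1]$. Hypothesis 1: there is a non-empty closed interval $\mathcal U=[\phi_m,\phi_M]\subsetneq\mathbb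 T$, $\phi_m<\phi_M$ (identified with an interval of $\mathbb R$), such that, with $\Omega=\mathcal U\times\mathbb T^2$, $1+\partial_\varphi F>0$ on $\Omega$, and $F(\phi_m,\psi)>0$, $F(\phi_M,\psi)<0$ for all $\psi$. Hypothesis 2: for every $\psi$ there is a unique $S(\psi)\in\operatorname{int}\mathcal U$ with $F(S(\psi),\psi)=0$. Set $S_m=\inf_\psi S$, $S_M=\sup_\psi S$, $\Lambda=[S_m,S_M]\times\mathbb T^2$, $\Gamma=-\sup_\Lambda\partial_\varphi F$. Hypothesis 3: $\Gamma>0$. Then $\mathcal S(\Omega)\subset\Omega$; $W$ is the unique function with graph in $\Lambda$ and $\mathcal S(W(\psi),\psi)=(W(A_0\psi),A_0\psi)$; it lies in $\mathfrak B^*_{\alpha_-,\alpha_+}$ for suitable $\alpha_\pm\in(0,\alpha_0]$. The conjugation is $\mathscr H(\varphi,\psi)=(\mathcal H(\varphi,\psi),\psi)$ on $\Omega$ with $\mathscr H\circ\mathcal S=\mathcal S_0\circ\mathscr H$, where $\mathcal S_0(\eta,\psi)=(\kappa(\psi)\eta,A_0\psi)$, $\kappa(\psi)=1+\partial_\varphi F(W(\psi),\psi)$, normalized by $\partial_\varphi\mathcal H(W(\psi),\psi)=1$; it exists and lies in $\mathscr B_{\alpha_*,2}(\Omega,\mathbb R)$ for suitable $\alpha_*\in(0,\min\{\alpha_-,\alpha_+\}]$. $\nu_0(d\varphi\,d\psi)=m_0(d\psi)\,d\varphi/(\phi_M-\phi_m)$ on $\Omega$, and $\nu_W(\mathcal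 O)=\int_{\mathbb T^2}\mathcal O(W(\psi),\psi)\,m_0(d\psi)$. *)

theory Defs
  imports "HOL-Analysis.Analysis"
begin

text \<open>
  The torus \<open>(\<real>/2\<pi>\<int>)\<^sup>2\<close> is represented by its universal cover: functions on it are functions
  on \<^typ>\<open>real^2\<close> that are \<open>2\<pi>\<close>-periodic in both coordinates.  Functions on \<open>U \<times> \<T>\<^sup>2\<close>, with \<open>U\<close> a
  set of real numbers, are functions on \<^typ>\<open>real \<times> (real^2)\<close> of which only the values over \<open>U\<close> matter.
\<close>

definition torus_fun :: "(real^2 \<Rightarrow> real) \<Rightarrow> bool" where
  "torus_fun h \<longleftrightarrow> (\<forall>\<psi> i. h (\<psi> + axis i (2 * pi)) = h \<psi>)"

definition torus_mean :: "(real^2 \<Rightarrow> real) \<Rightarrow> real" where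
  "torus_mean h = (LINT \<psi>:cbox 0 (\<chi> i. 2 * pi)|lborel. h \<psi>) / (2 * pi)\<^sup>2"

text \<open>
  An integer matrix of determinant \<open>\<plusminus>1\<close> induces an automorphism of the torus.  It is hyperbolic when
  its eigenvalues \<open>lp\<close>, \<open>lm\<close> satisfy the inequalities below; \<open>vp\<close>, \<open>vm\<close> are unit eigenvectors.
\<close>

definition anosov_automorphism ::
    "real^2^2 \<Rightarrow> real \<Rightarrow> real \<Rightarrow> real^2 \<Rightarrow> real^2 \<Rightarrow> bool" where
  "anosov_automorphism A lp lm vp vm \<longleftrightarrow>
     (\<forall>i j. A $ i $ j \<in> \<int>) \<and> \<bar>det A\<bar> = 1 \<and>
     A *v vp = lp *\<^sub>R vp \<and> norm vp = 1 \<and>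
     A *v vm = lm *\<^sub>R vm \<and> norm vm = 1 \<and>
     \<bar>lp\<bar> > 1 \<and> 1 > \<bar>lm\<bar>"

definition sup_norm :: "'a set \<Rightarrow> ('a \<Rightarrow> real) \<Rightarrow> ennreal" where
  "sup_norm D g = (SUP x\<in>D. ennreal \<bar>g x\<bar>)"

definition dir_seminorm :: "real^2 \<Rightarrow> real \<Rightarrow> (real^2 \<Rightarrow> real) \<Rightarrow> ennreal" where
  "dir_seminorm v \<alpha> g =
     (SUP \<psi>. SUP x\<in>- {0}. ennreal (\<bar>g (\<psi> + x *\<^sub>R v) - g \<psi>\<bar> / \<bar>x\<bar> powr \<alpha>))"

definition B_star :: "real^2 \<Rightarrow> real^2 \<Rightarrow> real \<Rightarrow> real \<Rightarrow> (real^2 \<Rightarrow> real) set" where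
  "B_star vm vp \<alpha>m \<alpha>p = {g. torus_fun g \<and> continuous_on UNIV g \<and>
     sup_norm UNIV g + ennreal \<alpha>m * dir_seminorm vm \<alpha>m g
       + ennreal \<alpha>p * dir_seminorm vp \<alpha>p g < \<infinity>}"

text \<open>
  For \<open>\<psi>\<close>-periodic \<open>g\<close> the supremum over the cover below equals the one over the torus with its
  quotient distance, which is the minimum of the Euclidean distances between lifts.
\<close>

definition holder_seminorm :: "real set \<Rightarrow> real \<Rightarrow> (real \<times> (real^2) \<Rightarrow> real) \<Rightarrow> ennreal" where
  "holder_seminorm U \<alpha> g =
     (SUP \<phi>\<in>U. SUP (\<psi>, \<psi>')\<in>{(\<psi>, \<psi>'). \<psi> \<noteq> \<psi>'}.
        ennreal (\<bar>g (\<phi>, \<psi>') - g (\<phi>, \<psi>)\<bar> / norm (\<psi>' - \<psi>) powr \<alpha>))"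

definition holder_norm :: "real set \<Rightarrow> real \<Rightarrow> (real \<times> (real^2) \<Rightarrow> real) \<Rightarrow> ennreal" where
  "holder_norm U \<alpha> g = sup_norm (U \<times> UNIV) g + ennreal \<alpha> * holder_seminorm U \<alpha> g"

text \<open>
  The derivative is taken within \<open>U\<close>, hence one-sided at the end points of a closed interval, so that
  it depends only on the values of \<open>g\<close> over \<open>U\<close>.
\<close>

definition dphi :: "real set \<Rightarrow> (real \<times> (real^2) \<Rightarrow> real) \<Rightarrow> (real \<times> (real^2) \<Rightarrow> real)" where
  "dphi U g = (\<lambda>(\<phi>, \<psi>). vector_derivative (\<lambda>t. g (t, \<psi>)) (at \<phi> within U))"

definition B_norm :: "real set \<Rightarrow> real \<Rightarrow> nat \<Rightarrow> (real \<times> (real^2) \<Rightarrow> real) \<Rightarrow> ennreal" where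
  "B_norm U \<alpha> k g =
     (\<Sum>n\<le>k. sup_norm (U \<times> UNIV) ((dphi U ^^ n) g))
       + ennreal \<alpha> * (\<Sum>n<k. holder_seminorm U \<alpha> ((dphi U ^^ n) g))"

definition B_space :: "real set \<Rightarrow> real \<Rightarrow> nat \<Rightarrow> (real \<times> (real^2) \<Rightarrow> real) set" where
  "B_space U \<alpha> k = {g.
     (\<forall>\<phi>\<in>U. torus_fun (\<lambda>\<psi>. g (\<phi>, \<psi>))) \<and>
     (\<forall>n<k. \<forall>\<phi>\<in>U. \<forall>\<psi>. (\<lambda>t. (dphi U ^^ n) g (t, \<psi>)) differentiable (at \<phi> within U)) \<and>
     (\<forall>\<psi>. continuous_on U (\<lambda>t. (dphi U ^^ k) g (t, \<psi>))) \<and>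
     B_norm U \<alpha> k g < \<infinity>}"

definition B_space_torus :: "real \<Rightarrow> nat \<Rightarrow> (real \<times> (real^2) \<Rightarrow> real) set" where
  "B_space_torus \<alpha> k = {g \<in> B_space UNIV \<alpha> k. \<forall>\<phi> \<psi>. g (\<phi> + 2 * pi, \<psi>) = g (\<phi>, \<psi>)}"

definition skew_map ::
    "(real \<times> (real^2) \<Rightarrow> real) \<Rightarrow> real^2^2 \<Rightarrow> real \<times> (real^2) \<Rightarrow> real \<times> (real^2)" where
  "skew_map F A = (\<lambda>(\<phi>, \<psi>). (\<phi> + F (\<phi>, \<psi>), A *v \<psi>))"

text \<open>
  \<open>[a, b]\<close> is the lift of a closed proper subinterval of the circle.  The first two conditions on \<open>F\<close>
  imply \<open>\<phi> + F (\<phi>, \<psi>) \<in> [a, b]\<close> in \<open>\<real>\<close> for \<open>\<phi> \<in> [a, b]\<close>, so no reduction modulo \<open>2\<pi>\<close> is needed.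
\<close>

definition hypothesis1 :: "(real \<times> (real^2) \<Rightarrow> real) \<Rightarrow> real \<Rightarrow> real \<Rightarrow> bool" where
  "hypothesis1 F a b \<longleftrightarrow>
     a < b \<and> b - a < 2 * pi \<and>
     (\<forall>p\<in>{a..b} \<times> UNIV. 1 + dphi UNIV F p > 0) \<and>
     (\<forall>\<psi>. F (a, \<psi>) > 0 \<and> F (b, \<psi>) < 0)"

definition hypothesis2 :: "(real \<times> (real^2) \<Rightarrow> real) \<Rightarrow> real \<Rightarrow> real \<Rightarrow> bool" where
  "hypothesis2 F a b \<longleftrightarrow> (\<forall>\<psi>. \<exists>!\<phi>. \<phi> \<in> {a<..<b} \<and> F (\<phi>, \<psi>) = 0)"

definition zero_curve :: "(real \<times> (real^2) \<Rightarrow> real) \<Rightarrow> real \<Rightarrow> real \<Rightarrow> real^2 \<Rightarrow> real" where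
  "zero_curve F a b \<psi> = (THE \<phi>. \<phi> \<in> {a<..<b} \<and> F (\<phi>, \<psi>) = 0)"

definition Lambda_set :: "(real \<times> (real^2) \<Rightarrow> real) \<Rightarrow> real \<Rightarrow> real \<Rightarrow> (real \<times> (real^2)) set" where
  "Lambda_set F a b = {(INF \<psi>. zero_curve F a b \<psi>)..(SUP \<psi>. zero_curve F a b \<psi>)} \<times> UNIV"

definition Gamma_const :: "(real \<times> (real^2) \<Rightarrow> real) \<Rightarrow> real \<Rightarrow> real \<Rightarrow> real" where
  "Gamma_const F a b = - (SUP p\<in>Lambda_set F a b. dphi UNIV F p)"

definition hypothesis3 :: "(real \<times> (real^2) \<Rightarrow> real) \<Rightarrow> real \<Rightarrow> real \<Rightarrow> bool" where
  "hypothesis3 F a b \<longleftrightarrow> Gamma_const F a b > 0"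

definition invariant_graph ::
    "(real \<times> (real^2) \<Rightarrow> real) \<Rightarrow> real^2^2 \<Rightarrow> real \<Rightarrow> real \<Rightarrow> (real^2 \<Rightarrow> real) \<Rightarrow> bool" where
  "invariant_graph F A a b W \<longleftrightarrow>
     (\<forall>\<psi>. (W \<psi>, \<psi>) \<in> Lambda_set F a b) \<and>
     (\<forall>\<psi>. skew_map F A (W \<psi>, \<psi>) = (W (A *v \<psi>), A *v \<psi>))"

definition linearized_map ::
    "(real \<times> (real^2) \<Rightarrow> real) \<Rightarrow> real^2^2 \<Rightarrow> (real^2 \<Rightarrow> real) \<Rightarrow> real \<times> (real^2) \<Rightarrow> real \<times> (real^2)" where
  "linearized_map F A W = (\<lambda>(\<eta>, \<psi>). ((1 + dphi UNIV F (W \<psi>, \<psi>)) * \<eta>, A *v \<psi>))"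

definition fibre_map :: "(real \<times> (real^2) \<Rightarrow> real) \<Rightarrow> real \<times> (real^2) \<Rightarrow> real \<times> (real^2)" where
  "fibre_map H = (\<lambda>(\<phi>, \<psi>). (H (\<phi>, \<psi>), \<psi>))"

definition linearizing_conjugation ::
    "(real \<times> (real^2) \<Rightarrow> real) \<Rightarrow> real^2^2 \<Rightarrow> real \<Rightarrow> real \<Rightarrow> (real^2 \<Rightarrow> real)
       \<Rightarrow> (real \<times> (real^2) \<Rightarrow> real) \<Rightarrow> bool" where
  "linearizing_conjugation F A a b W H \<longleftrightarrow>
     (\<forall>p\<in>{a..b} \<times> UNIV.
        fibre_map H (skew_map F A p) = linearized_map F A W (fibre_map H p)) \<and>
     (\<forall>\<psi>. dphi {a..b} H (W \<psi>, \<psi>) = 1)"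

text \<open>
  Set integrals are used because an observable may be non-measurable away from \<open>[a, b] \<times> \<T>\<^sup>2\<close>.
\<close>

definition nu_0 :: "real \<Rightarrow> real \<Rightarrow> (real \<times> (real^2) \<Rightarrow> real) \<Rightarrow> real" where
  "nu_0 a b f =
     (LINT p:{a..b} \<times> cbox 0 (\<chi> i. 2 * pi)|lborel. f p) / ((2 * pi)\<^sup>2 * (b - a))"

definition nu_W :: "(real^2 \<Rightarrow> real) \<Rightarrow> (real \<times> (real^2) \<Rightarrow> real) \<Rightarrow> real" where
  "nu_W W f = torus_mean (\<lambda>\<psi>. f (W \<psi>, \<psi>))"

end

theory Submission
  imports Defs "HOL-Library.Real_Mod"
begin

text \<open>
  Near \<open>[S\<^sub>m, S\<^sub>M]\<close> the fibre maps contract by a factor close to \<open>1 - \<Gamma>\<close>, and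
  by compactness every fibre enters such a neighbourhood after a bounded number of steps.  So
  \<open>O2 \<circ> S\<^sup>n\<close> may be replaced by \<open>O2\<close> on the graph of \<open>W\<close>, a Hoelder function of \<open>A\<^sup>n \<psi>\<close>, and on each
  fibre only the decay of correlations of \<open>A\<close> remains.  For this one approximates both observables by
  trigonometric polynomials.  The expanding and contracting components of a nonzero integer frequency
  have product bounded away from zero, so polynomials of degrees \<open>R\<close>, \<open>R'\<close> with
  \<open>R * R' \<le> c * \<lambda>\<^sup>n\<close> are exactly uncorrelated at time \<open>n\<close>; telescoping over the scales gives the rate
  \<open>n * \<lambda> powr (- \<alpha> * n)\<close>.
\<close>

subsection \<open>Trigonometric approximation\<close>

text \<open>One pair of approximants does not suffice: with \<open>R * R'\<close> limited by
  \<open>c * \<lambda> ^ n\<close>, the better choice \<open>R = R'\<close> leaves an error of order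
  \<open>\<lambda> powr (- \<alpha> * n / 2)\<close>, half the desired exponent. Telescoping lets
  every scale divide the frequency budget in its own way and recovers the full exponent; the factor
  \<open>n\<close> that this costs is absorbed by the strict inequality assumed for
  \<open>inverse ls\<close>. The decay constant is the same for all pairs of Hoelder functions, so
  it can be used on every fibre with \<open>\<phi>\<close> frozen. This is why \<open>O1\<close>
  enters the bound only through its Hoelder norm in \<open>\<psi>\<close>, whereas
  \<open>O2\<close>, which is moved along the fibre onto the graph, also contributes its
  \<open>\<phi>\<close>-derivative. The approximants are averages of finitely many samples with
  nonnegative weights: being finite sums of characters they need no interchange of integrals, and by
  positivity the error is an average of \<open>\<bar>f p - f x\<bar>\<close>.\<close>

lemma sum_cis_nodes:
  fixes k :: int and M :: nat
  assumes "0 < M" "\<bar>k\<bar> < int M"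
  shows "(\<Sum>j<M. cis (of_int k * (2 * pi * real j / real M))) = (if k = 0 then of_nat M else 0)"
proof (cases "k = 0")
  case False
  define z where "z = cis (2 * pi * of_int k / real M)"
  have "cis (of_int k * (2 * pi * real j / real M)) = z ^ j" for j
    unfolding z_def Complex.DeMoivre by (rule arg_cong[of _ _ cis]) (simp add: field_simps)
  moreover have "z ^ M = 1"
    using assms cis_multiple_2pi[of "of_int k"] by (simp add: z_def Complex.DeMoivre)
  moreover have "z \<noteq> 1"
  proof
    assume "z = 1"
    then obtain n :: int where "2 * pi * of_int k / real M = of_int n * (2 * pi)"
      by (auto simp: z_def cis_eq_1_iff)
    then have "real_of_int k = of_int (n * int M)"
      using assms by (simp add: field_simps)
    then have "k = n * int M" by linarith
    then show False
      using assms False by (auto simp: abs_mult)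
  qed
  ultimately show ?thesis
    using False by (simp add: geometric_sum)
qed (use assms in simp)

text \<open>Bounds the squared distance on the circle by \<open>1 - cos v\<close>, a trigonometric
  polynomial of degree one, whose average under the weights below is a single moment.\<close>

lemma cos_quadratic_bound:
  fixes v :: real
  assumes "\<bar>v\<bar> \<le> pi"
  shows "v\<^sup>2 \<le> 8 * (1 - cos v)"
proof -
  have tan: "y * cos y \<le> sin y" if "0 \<le> y" "y \<le> pi" for y :: real
  proof -
    have "sin 0 - 0 * cos 0 \<le> sin y - y * cos y"
    proof (rule DERIV_nonneg_imp_nondecreasing[OF that(1)])
      fix x assume "0 \<le> x" "x \<le> y"
      then show "\<exists>d. ((\<lambda>a. sin a - a * cos a) has_real_derivative d) (at x) \<and> 0 \<le> d"
        using that by (intro exI[of _ "x * sin x"])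
          (auto intro!: derivative_eq_intros mult_nonneg_nonneg sin_ge_zero)
    qed
    then show ?thesis by simp
  qed
  \<comment> \<open>A quarter of the angle: \<open>2 * y\<close> is at most \<open>pi / 2\<close>,
    which gives \<open>(cos y)^2 >= 1 / 2\<close>, and squaring \<open>y <= sin (2 * y)\<close>
    yields the constant 16 / 2 = 8.\<close>
  define y where "y = \<bar>v\<bar> / 4"
  have y: "0 \<le> y" "y \<le> pi / 4" using assms by (auto simp: y_def)
  have "2 * (cos y)\<^sup>2 - 1 = cos (2 * y)" by (simp add: cos_double_cos)
  moreover have "0 \<le> cos (2 * y)" using y by (intro cos_ge_zero) auto
  ultimately have c: "1 / 2 \<le> (cos y)\<^sup>2" by linarith
  have "y \<le> 2 * (y * (cos y)\<^sup>2)" 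
    using mult_left_mono[OF c y(1)] by simp
  also have "\<dots> = 2 * (y * cos y) * cos y" by (simp add: power2_eq_square)
  also have "\<dots> \<le> 2 * sin y * cos y"
    using y tan[of y] by (intro mult_right_mono mult_left_mono cos_ge_zero) auto
  also have "\<dots> = sin (2 * y)" by (simp add: sin_double)
  finally have "y\<^sup>2 \<le> (sin (2 * y))\<^sup>2" using y(1) by (rule power_mono)
  moreover have "cos v = 1 - 2 * (sin (2 * y))\<^sup>2"
    using cos_double_sin[of "2 * y"] by (cases "0 \<le> v") (simp_all add: y_def)
  moreover have "v\<^sup>2 = 16 * y\<^sup>2" by (simp add: y_def power_divide)
  ultimately show ?thesis by simp
qed

text \<open>
  The weights are samples of the Fejer--Korovkin kernel
  \<open>\<bar>\<Sum>k<N. sin (pi k / N) e\<^sup>i\<^sup>k\<^sup>u\<bar>\<^sup>2\<close>.  The coefficients vary slowly, hence the second moment is \<open>O(N\<^sup>-\<^sup>2)\<close>;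
  with \<open>N + 1\<close> nodes the sampled moments are exact.
\<close>

definition fk_coeff :: "nat \<Rightarrow> nat \<Rightarrow> real" where
  "fk_coeff N k = sin (pi * real k / real N)"

definition node :: "nat \<Rightarrow> nat \<Rightarrow> real" where
  "node N j = 2 * pi * real j / real (Suc N)"

text \<open>The factor cancels the number \<open>N + 1\<close> of nodes and the sum
  \<open>N / 2\<close> of the squared coefficients, so that for \<open>2 <= N\<close> the weights
  sum to one.\<close>

definition fk_weight :: "nat \<Rightarrow> nat \<Rightarrow> real \<Rightarrow> real" where
  "fk_weight N j u = 2 / (real N * real (Suc N)) *
     (cmod (\<Sum>k<N. of_real (fk_coeff N k) * cis (real k * (u - node N j))))\<^sup>2"

lemma fk_weight_nonneg: "0 \<le> fk_weight N j u"
  by (simp add: fk_weight_def)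

lemma fk_weight_expand:
  "complex_of_real (fk_weight N j u) =
     (\<Sum>k<N. \<Sum>l<N. of_real (2 / (real N * real (Suc N)) * fk_coeff N k * fk_coeff N l) *
        cis (of_int (int k - int l) * (u - node N j)))"
proof -
  let ?v = "u - node N j"
  let ?P = "\<Sum>k<N. of_real (fk_coeff N k) * cis (real k * ?v)"
  have "complex_of_real ((cmod ?P)\<^sup>2) = ?P * cnj ?P"
    by (simp add: complex_norm_square del: of_real_power)
  also have "\<dots> = (\<Sum>k<N. \<Sum>l<N. of_real (fk_coeff N k) * cis (real k * ?v) *
      (of_real (fk_coeff N l) * cis (- (real l * ?v))))"
    by (simp add: sum_product cis_cnj)
  also have "\<dots> = (\<Sum>k<N. \<Sum>l<N. of_real (fk_coeff N k * fk_coeff N l) * cis (of_int (int k - int l) * ?v))"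
  proof (intro sum.cong refl)
    fix k l
    have "cis (real k * ?v) * cis (- (real l * ?v)) = cis (of_int (int k - int l) * ?v)"
      by (simp add: cis_mult algebra_simps)
    then show "of_real (fk_coeff N k) * cis (real k * ?v) * (of_real (fk_coeff N l) * cis (- (real l * ?v)))
        = complex_of_real (fk_coeff N k * fk_coeff N l) * cis (of_int (int k - int l) * ?v)"
      by (simp add: algebra_simps)
  qed
  finally show ?thesis
    unfolding fk_weight_def by (simp only: of_real_mult sum_distrib_left mult.assoc)
qed

lemma sum_fk_coeff_square:
  assumes "2 \<le> N"
  shows "(\<Sum>k<N. (fk_coeff N k)\<^sup>2) = real N / 2"
proof -
  have "(\<Sum>k<N. cis (of_int 1 * (2 * pi * real k / real N))) = 0"
    using sum_cis_nodes[of N 1] assms by simp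
  then have "Re (\<Sum>k<N. cis (of_int 1 * (2 * pi * real k / real N))) = 0" by simp
  then have "(\<Sum>k<N. cos (2 * pi * real k / real N)) = 0" by simp
  moreover have "(fk_coeff N k)\<^sup>2 = (1 - cos (2 * pi * real k / real N)) / 2" for k
    using cos_double_sin[of "pi * real k / real N"] by (simp add: fk_coeff_def mult.assoc)
  ultimately show ?thesis
    by (simp only: sum_divide_distrib[symmetric] sum_subtractf) simp
qed

text \<open>The frequencies \<open>k - l + s\<close> have modulus at most \<open>N\<close>, below
  the number \<open>N + 1\<close> of nodes, so summation over the nodes kills every nonzero one
  without aliasing. All dependence on \<open>u\<close> disappears with them.\<close>

lemma fk_weight_moment:
  fixes s :: int
  assumes "2 \<le> N" "\<bar>s\<bar> \<le> 1"
  shows "(\<Sum>j\<le>N. of_real (fk_weight N j u) * cis (of_int s * (u - node N j))) =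
    complex_of_real (2 / real N * (\<Sum>k<N. \<Sum>l<N. if int k - int l + s = 0 then fk_coeff N k * fk_coeff N l else 0))"
proof -
  let ?c = "\<lambda>k l. complex_of_real (2 / (real N * real (Suc N)) * fk_coeff N k * fk_coeff N l)"
  have "(\<Sum>j\<le>N. of_real (fk_weight N j u) * cis (of_int s * (u - node N j))) =
    (\<Sum>j\<le>N. \<Sum>k<N. \<Sum>l<N. ?c k l * cis (of_int (int k - int l + s) * (u - node N j)))"
    unfolding fk_weight_expand sum_distrib_right
    by (intro sum.cong refl) (simp only: mult.assoc cis_mult distrib_right[symmetric] of_int_add)
  also have "\<dots> = (\<Sum>k<N. \<Sum>j\<le>N. \<Sum>l<N. ?c k l * cis (of_int (int k - int l + s) * (u - node N j)))"
    by (rule sum.swap)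
  also have "\<dots> = (\<Sum>k<N. \<Sum>l<N. \<Sum>j\<le>N. ?c k l * cis (of_int (int k - int l + s) * (u - node N j)))"
    by (intro sum.cong refl sum.swap)
  also have "\<dots> = (\<Sum>k<N. \<Sum>l<N. of_real (2 / real N * (if int k - int l + s = 0 then fk_coeff N k * fk_coeff N l else 0)))"
  proof (intro sum.cong refl)
    fix k l assume kl: "k \<in> {..<N}" "l \<in> {..<N}"
    let ?m = "int k - int l + s"
    have "cis (of_int ?m * (u - node N j)) =
        cis (of_int ?m * u) * cis (of_int (- ?m) * (2 * pi * real j / real (Suc N)))" for j
      unfolding cis_mult node_def
      by (rule arg_cong[of _ _ cis]) (simp only: distrib_left of_int_minus mult_minus_left mult_minus_right diff_conv_add_uminus)
    then have "(\<Sum>j\<le>N. ?c k l * cis (of_int ?m * (u - node N j))) = 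
       ?c k l * cis (of_int ?m * u) * (\<Sum>j<Suc N. cis (of_int (- ?m) * (2 * pi * real j / real (Suc N))))"
      by (simp only: sum_distrib_left lessThan_Suc_atMost mult.assoc)
    also have "(\<Sum>j<Suc N. cis (of_int (- ?m) * (2 * pi * real j / real (Suc N)))) = (if - ?m = 0 then of_nat (Suc N) else 0)"
      by (rule sum_cis_nodes) (use kl assms in auto)
    also have "?c k l * cis (of_int ?m * u) * (if - ?m = 0 then of_nat (Suc N) else 0) =
       of_real (2 / real N * (if ?m = 0 then fk_coeff N k * fk_coeff N l else 0))"
    proof (cases "?m = 0")
      case True
      have "complex_of_nat (Suc N) \<noteq> 0" by (simp only: of_nat_eq_0_iff)
      then show ?thesis
        unfolding True by (simp add: field_simps del: of_nat_Suc)
    next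
      case False
      then show ?thesis by (simp only: neg_equal_0_iff_equal if_False) simp
    qed
    finally show "(\<Sum>j\<le>N. ?c k l * cis (of_int ?m * (u - node N j))) =
       of_real (2 / real N * (if ?m = 0 then fk_coeff N k * fk_coeff N l else 0))" .
  qed
  finally show ?thesis
    by (simp add: sum_distrib_left)
qed

lemma sum_fk_weight:
  assumes "2 \<le> N"
  shows "(\<Sum>j\<le>N. fk_weight N j u) = 1"
proof -
  have "(\<Sum>k<N. \<Sum>l<N. if int k - int l + 0 = 0 then fk_coeff N k * fk_coeff N l else 0)
     = (\<Sum>k<N. (fk_coeff N k)\<^sup>2)"
    by (intro sum.cong refl) (simp add: power2_eq_square)
  note coeff = this
  have "complex_of_real (\<Sum>j\<le>N. fk_weight N j u)
      = (\<Sum>j\<le>N. of_real (fk_weight N j u) * cis (of_int 0 * (u - node N j)))"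
    by simp
  also have "\<dots> = complex_of_real (2 / real N * (\<Sum>k<N. (fk_coeff N k)\<^sup>2))"
    unfolding coeff[symmetric] using assms by (intro fk_weight_moment) auto
  also have "\<dots> = of_real 1"
    using assms by (simp only: sum_fk_coeff_square[OF assms]) simp
  finally show ?thesis by (simp only: of_real_eq_iff)
qed

text \<open>By exactness the moment is one minus a normalized sum of products of neighbouring
  coefficients, that is, the sum of their squared increments divided by \<open>N\<close>. Each
  increment is at most \<open>pi / N\<close>, which leaves \<open>pi^2 / N^2\<close>.\<close>

lemma fk_weight_cos_moment:
  assumes "2 \<le> N"
  shows "(\<Sum>j\<le>N. fk_weight N j u * (1 - cos (u - node N j))) \<le> 16 / (real N)\<^sup>2"
proof -
  have N: "fk_coeff N N = 0" using assms by (simp add: fk_coeff_def)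
  have 0: "fk_coeff N 0 = 0" by (simp add: fk_coeff_def)
  let ?S = "\<Sum>k<N. fk_coeff N k * fk_coeff N (Suc k)"
  have "(\<Sum>k<N. \<Sum>l<N. if int k - int l + 1 = 0 then fk_coeff N k * fk_coeff N l else 0) = ?S"
  proof (intro sum.cong refl)
    fix k assume k: "k \<in> {..<N}"
    have "(\<Sum>l<N. if int k - int l + 1 = 0 then fk_coeff N k * fk_coeff N l else 0)
       = (\<Sum>l<N. if Suc k = l then fk_coeff N k * fk_coeff N l else 0)"
      by (intro sum.cong refl) auto
    \<comment> \<open>For \<open>k = N - 1\<close> the partner index \<open>N\<close> is outside the
      range, but its coefficient is zero.\<close>
    then show "(\<Sum>l<N. if int k - int l + 1 = 0 then fk_coeff N k * fk_coeff N l else 0) =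
       fk_coeff N k * fk_coeff N (Suc k)"
      using k N by (cases "Suc k = N") auto
  qed
  then have "(\<Sum>j\<le>N. of_real (fk_weight N j u) * cis (of_int 1 * (u - node N j))) = complex_of_real (2 / real N * ?S)"
    using fk_weight_moment[OF assms, of 1 u] by simp
  then have "Re (\<Sum>j\<le>N. of_real (fk_weight N j u) * cis (of_int 1 * (u - node N j))) = 2 / real N * ?S"
    by simp
  then have cos: "(\<Sum>j\<le>N. fk_weight N j u * cos (u - node N j)) = 2 / real N * ?S"
    by simp
  \<comment> \<open>The coefficients vanish at both ends, so shifting the index leaves the sum of
    squares unchanged.\<close>
  have "(\<Sum>k<N. (fk_coeff N (Suc k))\<^sup>2) = (\<Sum>k<N. (fk_coeff N k)\<^sup>2)"
    using sum.lessThan_Suc_shift[of "\<lambda>k. (fk_coeff N k)\<^sup>2" N] N 0 by simp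
  then have *: "(\<Sum>k<N. (fk_coeff N (Suc k) - fk_coeff N k)\<^sup>2) = real N - 2 * ?S"
    using sum_fk_coeff_square[OF assms]
    by (simp add: power2_diff sum.distrib sum_subtractf mult.assoc sum_distrib_left[symmetric] mult.commute[of "fk_coeff N (Suc _)"])
  have "(\<Sum>k<N. (fk_coeff N (Suc k) - fk_coeff N k)\<^sup>2) \<le> (\<Sum>k<N. (pi / real N)\<^sup>2)"
  proof (rule sum_mono)
    fix k
    let ?x = "pi * real k / real N" and ?y = "pi * real (Suc k) / real N"
    have "\<bar>sin ?y - sin ?x\<bar> = 2 * \<bar>sin ((?y - ?x) / 2)\<bar> * \<bar>cos ((?y + ?x) / 2)\<bar>"
      by (simp add: sin_diff_sin abs_mult)
    also have "\<dots> \<le> 2 * \<bar>(?y - ?x) / 2\<bar> * 1"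
      by (intro mult_mono mult_left_mono abs_sin_x_le_abs_x abs_cos_le_one) auto
    also have "\<dots> = pi / real N" using assms by (simp add: field_simps abs_if)
    finally have "\<bar>fk_coeff N (Suc k) - fk_coeff N k\<bar> \<le> pi / real N" by (simp add: fk_coeff_def)
    from power_mono[OF this abs_ge_zero, of 2]
    show "(fk_coeff N (Suc k) - fk_coeff N k)\<^sup>2 \<le> (pi / real N)\<^sup>2" by simp
  qed
  then have le: "real N - 2 * ?S \<le> pi\<^sup>2 / real N"
    using * assms by (simp add: power_divide power2_eq_square)
  have "(\<Sum>j\<le>N. fk_weight N j u * (1 - cos (u - node N j))) = 1 - 2 / real N * ?S"
    using cos sum_fk_weight[OF assms, of u] by (simp add: algebra_simps sum_subtractf)
  also have "\<dots> = (real N - 2 * ?S) / real N" using assms by (simp add: field_simps)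
  also have "\<dots> \<le> pi\<^sup>2 / real N / real N" using le by (intro divide_right_mono) auto
  also have "\<dots> \<le> 16 / (real N)\<^sup>2"
  proof -
    have "pi\<^sup>2 \<le> 4\<^sup>2" using pi_less_4 by (intro power_mono) auto
    then show ?thesis using assms by (simp add: power2_eq_square field_simps)
  qed
  finally show ?thesis .
qed

section \<open>Trigonometric polynomials on the torus\<close>

definition torus_char :: "int \<Rightarrow> int \<Rightarrow> real^2 \<Rightarrow> complex" where
  "torus_char k l x = cis (of_int k * x $ 1 + of_int l * x $ 2)"

text \<open>Generated inductively, so that identities linear in the polynomial need only be checked
  on characters. The degree is real because it will be \<open>\<bar>lp\<bar> ^ i\<close> or a
  multiple of it. Strict bounds on the frequencies let the non-strict budget
  \<open>R * R' \<le> c * \<bar>lp\<bar> ^ n\<close> exclude resonances.\<close>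

inductive_set trig_poly :: "real \<Rightarrow> (real^2 \<Rightarrow> complex) set" for R where
  torus_char: "\<bar>of_int k\<bar> < R \<Longrightarrow> \<bar>of_int l\<bar> < R \<Longrightarrow> torus_char k l \<in> trig_poly R"
| scale: "p \<in> trig_poly R \<Longrightarrow> (\<lambda>x. c * p x) \<in> trig_poly R"
| add: "p \<in> trig_poly R \<Longrightarrow> q \<in> trig_poly R \<Longrightarrow> (\<lambda>x. p x + q x) \<in> trig_poly R"

lemma trig_poly_const:
  assumes "0 < R"
  shows "(\<lambda>x. c) \<in> trig_poly R"
  using trig_poly.scale[OF trig_poly.torus_char[of 0 R 0], of c] assms
  by (simp add: torus_char_def)

lemma trig_poly_sum:
  assumes "0 < R" "\<And>i. i \<in> I \<Longrightarrow> p i \<in> trig_poly R"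
  shows "(\<lambda>x. \<Sum>i\<in>I. p i x) \<in> trig_poly R"
  using assms(2)
  by (induction I rule: infinite_finite_induct) (auto intro: trig_poly.add trig_poly_const assms(1))

lemma trig_poly_diff:
  assumes "p \<in> trig_poly R" "q \<in> trig_poly R"
  shows "(\<lambda>x. p x - q x) \<in> trig_poly R"
  using trig_poly.add[OF assms(1) trig_poly.scale[OF assms(2), of "-1"]] by simp

lemma trig_poly_mono:
  assumes "p \<in> trig_poly R" "R \<le> R'"
  shows "p \<in> trig_poly R'"
  using assms(1) by induction (use assms(2) in \<open>auto intro: trig_poly.intros\<close>)

lemma continuous_on_trig_poly:
  assumes "p \<in> trig_poly R"
  shows "continuous_on S p"
  using assms by induction (auto simp: torus_char_def[abs_def] intro!: continuous_intros)

section \<open>Approximation of Hoelder functions on the torus\<close>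

lemma torus_fun_shift:
  assumes "torus_fun f"
  shows "f (x + axis i (2 * pi * of_int m)) = f x"
proof -
  have "f (x + axis i (2 * pi * real n)) = f x" for n x
  proof (induction n)
    case (Suc n)
    have "x + axis i (2 * pi * real (Suc n)) = (x + axis i (2 * pi * real n)) + axis i (2 * pi)"
      by (simp add: vec_eq_iff axis_def algebra_simps)
    then show ?case using assms Suc by (simp only: torus_fun_def)
  qed (simp add: axis_def zero_vec_def[symmetric])
  note nat = this
  show ?thesis
  proof (cases "0 \<le> m")
    case True
    then show ?thesis using nat[of x "nat m"] by simp
  next
    case False
    have eq: "(x + axis i (2 * pi * of_int m)) + axis i (2 * pi * real (nat (- m))) = x"
      using False by (simp add: vec_eq_iff axis_def)
    show ?thesis using nat[of "x + axis i (2 * pi * of_int m)" "nat (- m)"] unfolding eq by simp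
  qed
qed

text \<open>Only second moments of the weights are controlled, so the modulus of continuity is split
  at a scale \<open>e\<close>: beyond it \<open>d powr (\<alpha> - 2)\<close> does not exceed its
  value at \<open>e\<close>, and what remains is a square.\<close>

lemma powr_le_split:
  fixes d e \<alpha> :: real
  assumes "0 \<le> d" "0 < e" "0 < \<alpha>" "\<alpha> \<le> 2"
  shows "d powr \<alpha> \<le> e powr \<alpha> + e powr (\<alpha> - 2) * d\<^sup>2"
proof (cases "d \<le> e")
  case True
  have "d powr \<alpha> \<le> e powr \<alpha>" using assms True by (intro powr_mono2) auto
  then show ?thesis by (simp add: add_increasing2)
next
  case False
  then have "0 < d" using assms by simp
  then have "d powr \<alpha> = d powr (\<alpha> - 2) * d powr 2" by (simp only: powr_add[symmetric]) simp
  also have "\<dots> = d powr (\<alpha> - 2) * d\<^sup>2" using \<open>0 < d\<close> by simp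
  also have "\<dots> \<le> e powr (\<alpha> - 2) * d\<^sup>2"
    using assms False by (intro mult_right_mono powr_mono2') auto
  finally show ?thesis by (simp add: add_increasing)
qed

text \<open>Rounding in each coordinate replaces \<open>p\<close> by its lattice translate nearest
  to \<open>x\<close>. Both coordinate differences are then at most \<open>pi\<close>, where
  \<open>cos_quadratic_bound\<close> applies, and neither \<open>f\<close> nor the cosines notice
  the translation.\<close>

lemma torus_holder_cos:
  fixes f :: "real^2 \<Rightarrow> real"
  assumes "torus_fun f" and holder: "\<And>x y. \<bar>f x - f y\<bar> \<le> L * norm (x - y) powr \<alpha>"
    and "0 < \<alpha>" "\<alpha> \<le> 1" "0 \<le> L" "0 < e"
  shows "\<bar>f p - f x\<bar> \<le> L * (e powr \<alpha> + e powr (\<alpha> - 2) *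
           (8 * ((1 - cos (x $ 1 - p $ 1)) + (1 - cos (x $ 2 - p $ 2)))))"
proof -
  have "\<exists>m::int. \<bar>u - 2 * pi * of_int m\<bar> \<le> pi" for u :: real
  proof -
    have "\<bar>of_int (round (u / (2 * pi))) - u / (2 * pi)\<bar> \<le> 1 / 2"
      by (rule of_int_round_abs_le)
    then have "2 * pi * \<bar>of_int (round (u / (2 * pi))) - u / (2 * pi)\<bar> \<le> 2 * pi * (1 / 2)"
      by (intro mult_left_mono) auto
    also have "2 * pi * \<bar>of_int (round (u / (2 * pi))) - u / (2 * pi)\<bar>
        = \<bar>2 * pi * (of_int (round (u / (2 * pi))) - u / (2 * pi))\<bar>"
      by (simp add: abs_mult)
    finally show ?thesis
      by (intro exI[of _ "round (u / (2 * pi))"]) (simp add: right_diff_distrib abs_minus_commute)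
  qed
  then have "\<forall>i. \<exists>m::int. \<bar>(x $ i - p $ i) - 2 * pi * of_int m\<bar> \<le> pi"
    by blast
  from choice[OF this]
  obtain m :: "2 \<Rightarrow> int" where m: "\<bar>(x $ i - p $ i) - 2 * pi * of_int (m i)\<bar> \<le> pi" for i
    by blast
  define q where "q = p + axis 1 (2 * pi * of_int (m 1)) + axis 2 (2 * pi * of_int (m 2))"
  have fq: "f q = f p"
    unfolding q_def using assms(1) by (simp add: torus_fun_shift)
  have q: "x $ i - q $ i = (x $ i - p $ i) - 2 * pi * of_int (m i)" for i
    using exhaust_2[of i] by (auto simp: q_def axis_def)
  have c: "(x $ i - q $ i)\<^sup>2 \<le> 8 * (1 - cos (x $ i - p $ i))" for i
    using cos_quadratic_bound[OF m[of i]] unfolding q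
    by (simp add: cos_diff[of _ "2 * pi * of_int (m i)"])
  have "(norm (q - x))\<^sup>2 = (x $ 1 - q $ 1)\<^sup>2 + (x $ 2 - q $ 2)\<^sup>2"
    unfolding power2_norm_eq_inner
    by (simp add: inner_vec_def UNIV_2 power2_eq_square algebra_simps)
  also have "\<dots> \<le> 8 * ((1 - cos (x $ 1 - p $ 1)) + (1 - cos (x $ 2 - p $ 2)))"
    using c[of 1] c[of 2] by simp
  finally have n: "(norm (q - x))\<^sup>2 \<le> 8 * ((1 - cos (x $ 1 - p $ 1)) + (1 - cos (x $ 2 - p $ 2)))" .
  have "\<bar>f p - f x\<bar> \<le> L * norm (q - x) powr \<alpha>" using holder[of q x] fq by simp
  also have "\<dots> \<le> L * (e powr \<alpha> + e powr (\<alpha> - 2) * (norm (q - x))\<^sup>2)"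
    using assms by (intro mult_left_mono powr_le_split) auto
  also have "\<dots> \<le> L * (e powr \<alpha> + e powr (\<alpha> - 2) *
           (8 * ((1 - cos (x $ 1 - p $ 1)) + (1 - cos (x $ 2 - p $ 2)))))"
    using n assms by (intro mult_left_mono add_left_mono) auto
  finally show ?thesis .
qed

text \<open>A discrete stand-in for convolution with the product kernel, still a finite sum of
  characters in \<open>x\<close>.\<close>

definition fk_approx :: "nat \<Rightarrow> (real^2 \<Rightarrow> real) \<Rightarrow> real^2 \<Rightarrow> real" where
  "fk_approx N f x = (\<Sum>i\<le>N. \<Sum>j\<le>N. fk_weight N i (x $ 1) * fk_weight N j (x $ 2) *
     f (vector [node N i, node N j]))"

lemma fk_approx_trig_poly:
  assumes "2 \<le> N" "real N \<le> R"
  shows "(\<lambda>x. of_real (fk_approx N f x)) \<in> trig_poly R"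
proof -
  have R: "0 < R" using assms by simp
  let ?c = "\<lambda>k l. complex_of_real (2 / (real N * real (Suc N)) * fk_coeff N k * fk_coeff N l)"
  let ?e = "\<lambda>k l t. cis (of_int (int k - int l) * t)"
  have char: "(\<lambda>x. ?c k l * ?e k l (x $ 1 - node N i) * (?c k' l' * ?e k' l' (x $ 2 - node N j)) * w) \<in> trig_poly R"
    if "k < N" "l < N" "k' < N" "l' < N" for k l k' l' i j w
  proof -
    have "(\<lambda>x. (?c k l * ?e k l (- node N i) * (?c k' l' * ?e k' l' (- node N j)) * w) *
        torus_char (int k - int l) (int k' - int l') x) \<in> trig_poly R"
      using assms that by (intro trig_poly.scale trig_poly.torus_char) auto
    also have "(\<lambda>x. (?c k l * ?e k l (- node N i) * (?c k' l' * ?e k' l' (- node N j)) * w) *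
        torus_char (int k - int l) (int k' - int l') x) =
      (\<lambda>x. ?c k l * ?e k l (x $ 1 - node N i) * (?c k' l' * ?e k' l' (x $ 2 - node N j)) * w)"
    proof
      fix x :: "real^2"
      have *: "?e k l (x $ 1 - node N i) * ?e k' l' (x $ 2 - node N j) =
         ?e k l (- node N i) * ?e k' l' (- node N j) * torus_char (int k - int l) (int k' - int l') x"
        unfolding torus_char_def cis_mult by (rule arg_cong[of _ _ cis]) (simp add: algebra_simps)
      have "?c k l * ?e k l (x $ 1 - node N i) * (?c k' l' * ?e k' l' (x $ 2 - node N j)) * w
         = ?c k l * ?c k' l' * w * (?e k l (x $ 1 - node N i) * ?e k' l' (x $ 2 - node N j))"
        by (simp only: mult_ac)
      then show "(?c k l * ?e k l (- node N i) * (?c k' l' * ?e k' l' (- node N j)) * w) *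
        torus_char (int k - int l) (int k' - int l') x =
        ?c k l * ?e k l (x $ 1 - node N i) * (?c k' l' * ?e k' l' (x $ 2 - node N j)) * w"
        unfolding * by (simp only: mult_ac)
    qed
    finally show ?thesis .
  qed
  have approx: "complex_of_real (fk_approx N f x) = (\<Sum>i\<le>N. \<Sum>j\<le>N.
      of_real (fk_weight N i (x $ 1)) * of_real (fk_weight N j (x $ 2)) * of_real (f (vector [node N i, node N j])))" for x
    by (simp add: fk_approx_def)
  show ?thesis
    unfolding approx fk_weight_expand sum_distrib_right sum_distrib_left
    by (intro trig_poly_sum R char) auto
qed

lemma fk_approx_error:
  assumes "torus_fun f" and holder: "\<And>x y. \<bar>f x - f y\<bar> \<le> L * norm (x - y) powr \<alpha>"
    and "0 < \<alpha>" "\<alpha> \<le> 1" "0 \<le> L" "2 \<le> N"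
  shows "\<bar>fk_approx N f x - f x\<bar> \<le> 257 * L * real N powr (- \<alpha>)"
proof -
  define w where "w i j = fk_weight N i (x $ 1) * fk_weight N j (x $ 2)" for i j
  have w0: "0 \<le> w i j" for i j by (simp add: w_def fk_weight_nonneg)
  have w1: "(\<Sum>i\<le>N. \<Sum>j\<le>N. w i j) = 1"
    using assms by (simp add: w_def sum_product[symmetric] sum_fk_weight)
  define u where "u i = 1 - cos (x $ 1 - node N i)" for i
  define v where "v j = 1 - cos (x $ 2 - node N j)" for j
  have "(\<Sum>i\<le>N. \<Sum>j\<le>N. w i j * u i) = (\<Sum>i\<le>N. \<Sum>j\<le>N. (fk_weight N i (x $ 1) * u i) * fk_weight N j (x $ 2))"
    by (simp add: w_def mult_ac)
  also have "\<dots> = (\<Sum>i\<le>N. fk_weight N i (x $ 1) * u i)"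
    using assms by (simp only: sum_product[symmetric] sum_fk_weight mult_1_right)
  finally have wu: "(\<Sum>i\<le>N. \<Sum>j\<le>N. w i j * u i) \<le> 16 / (real N)\<^sup>2"
    using fk_weight_cos_moment[OF assms(6)] by (simp add: u_def)
  have "(\<Sum>i\<le>N. \<Sum>j\<le>N. w i j * v j) = (\<Sum>i\<le>N. \<Sum>j\<le>N. fk_weight N i (x $ 1) * (fk_weight N j (x $ 2) * v j))"
    by (simp add: w_def mult_ac)
  also have "\<dots> = (\<Sum>j\<le>N. fk_weight N j (x $ 2) * v j)"
    using assms by (simp only: sum_product[symmetric] sum_fk_weight mult_1_left)
  finally have wv: "(\<Sum>i\<le>N. \<Sum>j\<le>N. w i j * v j) \<le> 16 / (real N)\<^sup>2"
    using fk_weight_cos_moment[OF assms(6)] by (simp add: v_def)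
  \<comment> \<open>At this scale both terms have size \<open>real N powr (- \<alpha>)\<close>. The
    two second moments add up to \<open>32 / N^2\<close>, so the constant is 1 + 8 * 32 =
    257.\<close>
  define e where "e = 1 / real N"
  have e: "0 < e" using assms by (simp add: e_def)
  let ?p = "\<lambda>i j. vector [node N i, node N j] :: real^2"
  have "fk_approx N f x - f x = (\<Sum>i\<le>N. \<Sum>j\<le>N. w i j * f (?p i j)) - (\<Sum>i\<le>N. \<Sum>j\<le>N. w i j) * f x"
    unfolding w1 by (simp add: fk_approx_def w_def)
  also have "\<dots> = (\<Sum>i\<le>N. \<Sum>j\<le>N. w i j * (f (?p i j) - f x))"
    by (simp add: sum_distrib_right sum_subtractf right_diff_distrib)
  finally have "\<bar>fk_approx N f x - f x\<bar> \<le> (\<Sum>i\<le>N. \<bar>\<Sum>j\<le>N. w i j * (f (?p i j) - f x)\<bar>)"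
    by (simp only: sum_abs)
  also have "\<dots> \<le> (\<Sum>i\<le>N. \<Sum>j\<le>N. \<bar>w i j * (f (?p i j) - f x)\<bar>)"
    by (intro sum_mono sum_abs)
  also have "\<dots> \<le> (\<Sum>i\<le>N. \<Sum>j\<le>N. w i j * (L * (e powr \<alpha> + e powr (\<alpha> - 2) * (8 * (u i + v j)))))"
  proof (intro sum_mono)
    fix i j
    have "\<bar>f (?p i j) - f x\<bar> \<le> L * (e powr \<alpha> + e powr (\<alpha> - 2) * (8 * (u i + v j)))"
      using torus_holder_cos[OF assms(1) holder assms(3-5) e, of "?p i j" x] by (simp add: u_def v_def)
    then show "\<bar>w i j * (f (?p i j) - f x)\<bar> \<le> w i j * (L * (e powr \<alpha> + e powr (\<alpha> - 2) * (8 * (u i + v j))))"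
      using w0 by (simp add: abs_mult mult_left_mono)
  qed
  also have "\<dots> = L * e powr \<alpha> * (\<Sum>i\<le>N. \<Sum>j\<le>N. w i j) +
      8 * L * e powr (\<alpha> - 2) * ((\<Sum>i\<le>N. \<Sum>j\<le>N. w i j * u i) + (\<Sum>i\<le>N. \<Sum>j\<le>N. w i j * v j))"
    by (simp add: sum_distrib_left sum.distrib[symmetric] algebra_simps)
  also have "\<dots> \<le> L * e powr \<alpha> * 1 + 8 * L * e powr (\<alpha> - 2) * (16 / (real N)\<^sup>2 + 16 / (real N)\<^sup>2)"
    unfolding w1 using wu wv assms(5) by (intro add_mono mult_left_mono order_refl) auto
  also have "8 * L * e powr (\<alpha> - 2) * (16 / (real N)\<^sup>2 + 16 / (real N)\<^sup>2) = 256 * L * e powr \<alpha>"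
  proof -
    have "e powr (\<alpha> - 2) = e powr \<alpha> / e\<^sup>2"
      using e by (simp add: powr_diff)
    then show ?thesis using e assms(6) by (simp add: e_def field_simps)
  qed
  also have "e powr \<alpha> = real N powr (- \<alpha>)"
    using assms(6) by (simp add: e_def powr_divide powr_minus_divide)
  finally show ?thesis by simp
qed

lemma trig_poly_approx:
  assumes "torus_fun f" and "\<And>x. \<bar>f x\<bar> \<le> M" and holder: "\<And>x y. \<bar>f x - f y\<bar> \<le> L * norm (x - y) powr \<alpha>"
    and "0 < \<alpha>" "\<alpha> \<le> 1" "0 \<le> L" "0 < R"
  shows "\<exists>p\<in>trig_poly R. \<forall>x. cmod (p x - of_real (f x)) \<le> 514 * (M + L) * R powr (- \<alpha>)"
proof (cases "R < 2")
  case True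
  have M: "0 \<le> M" using assms(2)[of 0] by linarith
  show ?thesis
  proof (intro bexI allI)
    show "(\<lambda>x. complex_of_real (f 0)) \<in> trig_poly R" using assms(7) by (rule trig_poly_const)
    fix x
    have "cmod (of_real (f 0) - of_real (f x)) = \<bar>f 0 - f x\<bar>"
      by (simp only: of_real_diff[symmetric] norm_of_real)
    also have "\<dots> \<le> 2 * M" using assms(2)[of 0] assms(2)[of x] by linarith
    also have "\<dots> \<le> 4 * M * R powr (- \<alpha>)"
    proof -
      have "(1/2::real) = 2 powr (- 1)" by (simp add: powr_minus_divide)
      also have "\<dots> \<le> 2 powr (- \<alpha>)" using assms by (intro powr_mono) auto
      also have "\<dots> \<le> R powr (- \<alpha>)" using assms True by (intro powr_mono2') auto
      finally have "4 * M * (1 / 2) \<le> 4 * M * R powr (- \<alpha>)"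
        using M by (intro mult_left_mono) auto
      then show ?thesis by simp
    qed
    also have "\<dots> \<le> 514 * (M + L) * R powr (- \<alpha>)"
      using M assms by (intro mult_right_mono) auto
    finally show "cmod (of_real (f 0) - of_real (f x)) \<le> 514 * (M + L) * R powr (- \<alpha>)" .
  qed
next
  case False
  \<comment> \<open>Rounding down loses at most a factor 2 in the degree and so at most a factor 2
    in the error: 514 = 2 * 257.\<close>
  define N where "N = nat \<lfloor>R\<rfloor>"
  have N: "2 \<le> N" "real N \<le> R" "R / 2 \<le> real N" using False by (auto simp: N_def) linarith+
  have M: "0 \<le> M" using assms(2)[of 0] by linarith
  show ?thesis
  proof (intro bexI allI)
    show "(\<lambda>x. complex_of_real (fk_approx N f x)) \<in> trig_poly R"
      using N by (intro fk_approx_trig_poly)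
    fix x
    have "cmod (of_real (fk_approx N f x) - of_real (f x)) = \<bar>fk_approx N f x - f x\<bar>"
      by (simp only: of_real_diff[symmetric] norm_of_real)
    also have "\<dots> \<le> 257 * L * real N powr (- \<alpha>)"
      using fk_approx_error[OF assms(1) holder assms(4-6) N(1)] .
    also have "\<dots> \<le> 257 * L * (2 * R powr (- \<alpha>))"
    proof -
      have "real N powr (- \<alpha>) \<le> (R / 2) powr (- \<alpha>)"
        using N assms by (intro powr_mono2') auto
      also have "\<dots> = 2 powr \<alpha> * R powr (- \<alpha>)"
        using assms by (simp add: powr_divide powr_minus_divide)
      also have "\<dots> \<le> 2 powr 1 * R powr (- \<alpha>)"
        using assms by (intro mult_right_mono powr_mono) auto
      finally show ?thesis using assms by (intro mult_left_mono) auto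
    qed
    also have "\<dots> \<le> 514 * (M + L) * R powr (- \<alpha>)"
      using M assms by (simp add: algebra_simps)
    finally show "cmod (of_real (fk_approx N f x) - of_real (f x)) \<le> 514 * (M + L) * R powr (- \<alpha>)" .
  qed
qed

subsection \<open>Torus averages of characters\<close>

abbreviation torus_cell :: "(real^2) set" where
  "torus_cell \<equiv> cbox 0 (\<chi> i. 2 * pi)"

text \<open>The averages in the theorem are Lebesgue integrals, the estimates use the gauge
  integral; for continuous functions on compact sets this passes from one to the other.\<close>

lemma compact_set_integral_eq_integral:
  fixes f :: "'a::euclidean_space \<Rightarrow> 'b::euclidean_space"
  assumes "compact S" "continuous_on S f"
  shows "(LINT x:S|lborel. f x) = integral S f"
  using borel_integrable_compact[OF assms]
  by (intro set_borel_integral_eq_integral) (simp add: set_integrable_def)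

lemma integral_cis:
  assumes "k \<noteq> (0::int)"
  shows "integral {0..2 * pi} (\<lambda>t. cis (of_int k * t)) = 0"
proof -
  let ?F = "\<lambda>t. cis (of_int k * t) / (\<i> * of_int k)"
  have "((\<lambda>t. cis (of_int k * t)) has_integral (?F (2 * pi) - ?F 0)) {0..2 * pi}"
  proof (rule fundamental_theorem_of_calculus)
    fix x
    show "(?F has_vector_derivative cis (of_int k * x)) (at x within {0..2 * pi})"
      unfolding has_vector_derivative_def using assms
      by (auto intro!: derivative_eq_intros simp: scaleR_conv_of_real mult.left_commute[of "of_real _" \<i>])
  qed auto
  moreover have "cis (of_int k * (2 * pi)) = 1"
    using cis_multiple_2pi[of "of_int k"] by (simp add: mult_ac)
  ultimately show ?thesis by (simp add: integral_unique)
qed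

text \<open>Lebesgue measure on the plane is the image of the product measure indexed by the two
  basis vectors, so the integral factors into one-dimensional ones, and a factor with nonzero
  frequency vanishes.\<close>

lemma integral_torus_char:
  assumes "(k, l) \<noteq> (0, 0)"
  shows "integral torus_cell (torus_char k l) = 0"
proof -
  define m where "m b = (if b = (axis 1 1 :: real^2) then k else l)" for b
  define g :: "real^2 \<Rightarrow> real \<Rightarrow> complex"
    where "g b t = indicator {0..2 * pi} t *\<^sub>R cis (of_int (m b) * t)" for b t
  have ne: "axis 1 1 \<noteq> (axis 2 1 :: real^2)"
    by (simp add: axis_eq_axis)
  have Basis: "(Basis :: (real^2) set) = {axis 1 1, axis 2 1}"
    by (auto simp: Basis_vec_def UNIV_2)
  have g_int: "integrable lborel (g b)" for b
    using borel_integrable_compact[of "{0..2 * pi}" "\<lambda>t. cis (of_int (m b) * t)"]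
    by (simp add: g_def[abs_def] continuous_intros)
  have g_zero: "integral\<^sup>L lborel (g b) = 0" if "m b \<noteq> 0" for b
  proof -
    have "integral\<^sup>L lborel (g b) = (LINT t:{0..2 * pi}|lborel. cis (of_int (m b) * t))"
      by (simp add: set_lebesgue_integral_def g_def[abs_def])
    also have "\<dots> = 0"
      using integral_cis[OF that]
      by (subst compact_set_integral_eq_integral) (auto intro!: continuous_intros)
    finally show ?thesis .
  qed
  interpret product_sigma_finite "\<lambda>_::real^2. lborel :: real measure" ..
  have cont: "continuous_on S (torus_char k l)" for S
    by (auto simp: torus_char_def[abs_def] intro!: continuous_intros)
  have meas: "(\<lambda>x. indicator torus_cell x *\<^sub>R torus_char k l x) \<in> borel_measurable borel"
    using borel_integrable_compact[OF compact_cbox cont] by (simp add: integrable_iff_bounded)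
  have "integral torus_cell (torus_char k l) = (\<integral>x. indicator torus_cell x *\<^sub>R torus_char k l x \<partial>lborel)"
    using compact_set_integral_eq_integral[OF compact_cbox cont]
    by (simp add: set_lebesgue_integral_def)
  also have "\<dots> = (\<integral>f. indicator torus_cell (\<Sum>b\<in>Basis. f b *\<^sub>R b) *\<^sub>R torus_char k l (\<Sum>b\<in>Basis. f b *\<^sub>R b)
      \<partial>Pi\<^sub>M Basis (\<lambda>_::real^2. lborel))"
    unfolding lborel_eq[where 'a="real^2"] using meas by (subst integral_distr) auto
  also have "\<dots> = (\<integral>f. (\<Prod>b\<in>Basis. g b (f b)) \<partial>Pi\<^sub>M Basis (\<lambda>_::real^2. lborel))"
  proof (rule Bochner_Integration.integral_cong[OF refl])
    fix f :: "real^2 \<Rightarrow> real"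
    let ?x = "\<Sum>b\<in>Basis. f b *\<^sub>R b"
    have x: "?x $ 1 = f (axis 1 1)" "?x $ 2 = f (axis 2 1)"
      using ne by (auto simp: Basis axis_def)
    have "?x \<in> torus_cell \<longleftrightarrow> f (axis 1 1) \<in> {0..2 * pi} \<and> f (axis 2 1) \<in> {0..2 * pi}"
      unfolding mem_box_cart forall_2 x by auto
    then have "indicator torus_cell ?x = indicator {0..2 * pi} (f (axis 1 1)) * (indicator {0..2 * pi} (f (axis 2 1)) :: real)"
      by (simp add: indicator_def)
    moreover have "torus_char k l ?x = cis (of_int k * f (axis 1 1)) * cis (of_int l * f (axis 2 1))"
      by (simp only: torus_char_def x cis_mult)
    ultimately show "indicator torus_cell ?x *\<^sub>R torus_char k l ?x = (\<Prod>b\<in>Basis. g b (f b))"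
      unfolding Basis using ne by (simp add: g_def m_def scaleR_conv_of_real)
  qed
  also have "\<dots> = (\<Prod>b\<in>Basis. integral\<^sup>L lborel (g b))"
    by (rule product_integral_prod) (auto simp: g_int)
  also have "\<dots> = 0"
    using assms ne g_zero[of "axis 1 1"] g_zero[of "axis 2 1"] by (auto simp: Basis m_def)
  finally show ?thesis .
qed

definition cmean :: "(real^2 \<Rightarrow> complex) \<Rightarrow> complex" where
  "cmean h = integral torus_cell h / of_real ((2 * pi)\<^sup>2)"

lemma content_torus_cell: "measure lborel torus_cell = (2 * pi)\<^sup>2"
  by (subst content_cbox_cart) (auto simp: power2_eq_square UNIV_2 interval_eq_empty_cart)

lemma cmean_const: "cmean (\<lambda>x. c) = c"
  by (simp add: cmean_def content_torus_cell scaleR_conv_of_real)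

lemma cmean_mult: "cmean (\<lambda>x. c * h x) = c * cmean h"
  by (simp add: cmean_def)

lemma cmean_add:
  assumes "continuous_on UNIV f" "continuous_on UNIV g"
  shows "cmean (\<lambda>x. f x + g x) = cmean f + cmean g"
  unfolding cmean_def
  by (subst integral_add)
     (auto intro!: integrable_continuous continuous_on_subset[OF assms(1)] continuous_on_subset[OF assms(2)]
       simp: add_divide_distrib)

lemma cmean_torus_char: "cmean (torus_char k l) = (if k = 0 \<and> l = 0 then 1 else 0)"
proof (cases "k = 0 \<and> l = 0")
  case True
  then have "torus_char k l = (\<lambda>x. 1)" by (auto simp: torus_char_def)
  then show ?thesis using True by (simp add: cmean_const)
qed (auto simp: cmean_def integral_torus_char)

lemma cmean_bound:
  assumes "continuous_on UNIV h" "\<And>x. cmod (h x) \<le> B"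
  shows "cmod (cmean h) \<le> B"
proof -
  have "0 \<le> B" using assms(2)[of 0] norm_ge_zero order_trans by blast
  moreover have "(h has_integral integral torus_cell h) torus_cell"
    by (intro integrable_integral integrable_continuous continuous_on_subset[OF assms(1)]) auto
  ultimately have "cmod (integral torus_cell h) \<le> B * measure lborel torus_cell"
    using assms(2) by (intro has_integral_bound) auto
  then have "cmod (integral torus_cell h) / (2 * pi)\<^sup>2 \<le> B"
    unfolding content_torus_cell by (simp only: divide_le_eq) simp
  then show ?thesis
    unfolding cmean_def norm_divide norm_of_real by simp
qed

lemma cmean_of_real:
  assumes "continuous_on UNIV h"
  shows "cmean (\<lambda>x. of_real (h x)) = of_real (torus_mean h)"
proof -
  have "h integrable_on torus_cell"
    by (intro integrable_continuous continuous_on_subset[OF assms]) auto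
  then have "((\<lambda>x. complex_of_real (h x)) has_integral of_real (integral torus_cell h)) torus_cell"
    by (intro has_integral_of_real integrable_integral)
  moreover have "(LINT \<psi>:torus_cell|lborel. h \<psi>) = integral torus_cell h"
    by (rule compact_set_integral_eq_integral) (auto intro: continuous_on_subset[OF assms])
  ultimately show ?thesis
    by (simp add: cmean_def torus_mean_def integral_unique)
qed

subsection \<open>Hyperbolic automorphisms and lattice points\<close>

lemma matrix_vector_mult_2:
  fixes A :: "real^2^2"
  shows "(A *v x) $ i = A $ i $ 1 * x $ 1 + A $ i $ 2 * x $ 2"
  by (simp add: matrix_vector_mult_def UNIV_2)

text \<open>Both eigenvalues solve the characteristic equation and they are distinct, so subtracting
  the equations gives the trace, and then the determinant. Parallel eigenvectors would share their
  eigenvalue.\<close>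

lemma anosov_eigenvalues:
  assumes "anosov_automorphism A lp lm vp vm"
  shows "lp + lm = A $ 1 $ 1 + A $ 2 $ 2" "\<bar>lp * lm\<bar> = 1" "vp $ 1 * vm $ 2 - vp $ 2 * vm $ 1 \<noteq> 0"
proof -
  have char: "\<mu>\<^sup>2 - (A $ 1 $ 1 + A $ 2 $ 2) * \<mu> + det A = 0"
    if "A *v v = \<mu> *\<^sub>R v" "norm v = 1" for \<mu> v
  proof -
    have 1: "A $ 1 $ 1 * v $ 1 + A $ 1 $ 2 * v $ 2 = \<mu> * v $ 1"
      and 2: "A $ 2 $ 1 * v $ 1 + A $ 2 $ 2 * v $ 2 = \<mu> * v $ 2"
      using that(1) by (simp_all add: vec_eq_iff forall_2 matrix_vector_mult_2)
    \<comment> \<open>The characteristic polynomial at \<open>\<mu>\<close>; eliminating one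
      coordinate from the eigenvector equations shows that it annihilates the other.\<close>
    let ?c = "\<mu>\<^sup>2 - (A $ 1 $ 1 + A $ 2 $ 2) * \<mu> + det A"
    have "?c * v $ 1 = 0" "?c * v $ 2 = 0"
      using 1 2 unfolding det_2 by algebra+
    moreover have "v \<noteq> 0" using that(2) by auto
    then have "v $ 1 \<noteq> 0 \<or> v $ 2 \<noteq> 0" by (simp add: vec_eq_iff forall_2)
    ultimately show ?thesis by auto
  qed
  have p: "A *v vp = lp *\<^sub>R vp" "norm vp = 1" and m: "A *v vm = lm *\<^sub>R vm" "norm vm = 1"
    and l: "\<bar>lp\<bar> > 1" "1 > \<bar>lm\<bar>" and d: "\<bar>det A\<bar> = 1"
    using assms by (auto simp: anosov_automorphism_def)
  have ne: "lp \<noteq> lm" using l by auto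
  have "(lp - lm) * (lp + lm - (A $ 1 $ 1 + A $ 2 $ 2)) = 0"
    using char[OF p] char[OF m] by algebra
  then show tr: "lp + lm = A $ 1 $ 1 + A $ 2 $ 2" using ne by simp
  have "lp * lm = det A" using char[OF p] unfolding tr[symmetric] by algebra
  then show "\<bar>lp * lm\<bar> = 1" using d by simp
  show "vp $ 1 * vm $ 2 - vp $ 2 * vm $ 1 \<noteq> 0"
  proof
    assume J: "vp $ 1 * vm $ 2 - vp $ 2 * vm $ 1 = 0"
    have n: "vp $ 1 * vp $ 1 + vp $ 2 * vp $ 2 = 1"
      using p(2) by (simp add: norm_eq_1 inner_vec_def UNIV_2)
    \<comment> \<open>With vanishing determinant \<open>vm\<close> coincides with its orthogonal
      projection onto the unit vector \<open>vp\<close>.\<close>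
    have "vm $ 1 = (vp $ 1 * vm $ 1 + vp $ 2 * vm $ 2) * vp $ 1"
      "vm $ 2 = (vp $ 1 * vm $ 1 + vp $ 2 * vm $ 2) * vp $ 2"
      using J n by algebra+
    then have "vm = (vp $ 1 * vm $ 1 + vp $ 2 * vm $ 2) *\<^sub>R vp" by (simp add: vec_eq_iff forall_2)
    then obtain c where c: "vm = c *\<^sub>R vp" by blast
    then have "A *v vm = lp *\<^sub>R vm" using p(1) by (simp add: matrix_vector_mult_scaleR)
    then have "lp *\<^sub>R vm = lm *\<^sub>R vm" using m(1) by metis
    then show False using ne m(2) by auto
  qed
qed

lemma Ints_abs_less_1: "x \<in> \<int> \<Longrightarrow> \<bar>x\<bar> < 1 \<Longrightarrow> x = (0::real)"
  using Ints_nonzero_abs_ge1 by fastforce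

text \<open>
  A lattice eigenvector of the transpose could be multiplied by \<open>lm\<close> again and again without leaving
  the lattice, since \<open>lp + lm\<close> is an integer.
\<close>

lemma anosov_no_lattice_eigenvector:
  assumes "anosov_automorphism A lp lm vp vm" "\<mu> \<in> {lp, lm}" "k \<in> \<int>" "l \<in> \<int>"
    and eig: "A $ 1 $ 1 * k + A $ 2 $ 1 * l = \<mu> * k" "A $ 1 $ 2 * k + A $ 2 $ 2 * l = \<mu> * l"
  shows "k = 0 \<and> l = 0"
proof -
  have A: "A $ i $ j \<in> \<int>" for i j using assms by (auto simp: anosov_automorphism_def)
  note tr = anosov_eigenvalues(1)[OF assms(1)]
  have lm: "\<bar>lm\<bar> < 1" "lm \<noteq> 0"
    using assms anosov_eigenvalues(2)[OF assms(1)] by (auto simp: anosov_automorphism_def)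
  have step: "lm * x \<in> \<int>" if "x \<in> \<int>" "\<mu> * x \<in> \<int>" for x
  proof (cases "\<mu> = lm")
    case False
    then have "lm * x = (A $ 1 $ 1 + A $ 2 $ 2) * x - \<mu> * x"
      using assms(2) unfolding tr[symmetric] by (auto simp: algebra_simps)
    then show ?thesis using that A by simp
  qed (use that in simp)
  have int: "lm ^ n * k \<in> \<int> \<and> lm ^ n * l \<in> \<int>" for n
  proof (induction n)
    case (Suc n)
    have "\<mu> * (lm ^ n * k) = A $ 1 $ 1 * (lm ^ n * k) + A $ 2 $ 1 * (lm ^ n * l)"
      "\<mu> * (lm ^ n * l) = A $ 1 $ 2 * (lm ^ n * k) + A $ 2 $ 2 * (lm ^ n * l)"
      using arg_cong[OF eig(1), of "\<lambda>y. lm ^ n * y"] arg_cong[OF eig(2), of "\<lambda>y. lm ^ n * y"]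
      by (simp_all add: algebra_simps)
    then have "\<mu> * (lm ^ n * k) \<in> \<int>" "\<mu> * (lm ^ n * l) \<in> \<int>"
      using Suc A by simp_all
    then show ?case using step Suc by (simp add: mult.assoc)
  qed (use assms in simp)
  have "x = 0" if "\<And>n. lm ^ n * x \<in> \<int>" for x
  proof -
    have "(\<lambda>n. lm ^ n * x) \<longlonglongrightarrow> 0 * x"
      using lm by (intro tendsto_mult tendsto_const LIMSEQ_power_zero) auto
    then have "\<forall>\<^sub>F n in sequentially. dist (lm ^ n * x) 0 < 1"
      by (intro tendstoD) auto
    then obtain n where "\<bar>lm ^ n * x\<bar> < 1" by (auto simp: eventually_sequentially)
    then show ?thesis using Ints_abs_less_1[OF that] lm by simp
  qed
  then show ?thesis using int by blast
qed

lemma matrix_power_eigenvector: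
  fixes A :: "real^2^2"
  assumes "A *v v = \<mu> *\<^sub>R v"
  shows "((*v) A ^^ n) v = \<mu> ^ n *\<^sub>R v"
  by (induction n) (simp_all add: assms matrix_vector_mult_scaleR mult.commute)

text \<open>
  For a lattice point \<open>w\<close> and its image \<open>u\<close> under the transpose, \<open>det [w, u]\<close> is a nonzero integer
  proportional to \<open>(w \<bullet> vp) * (w \<bullet> vm)\<close>.
\<close>

lemma anosov_diophantine:
  assumes "anosov_automorphism A lp lm vp vm"
  shows "\<exists>c>0. \<forall>n k l k' l'. k' \<in> \<int> \<longrightarrow> l' \<in> \<int> \<longrightarrow> (k', l') \<noteq> (0, 0) \<longrightarrow>
    (\<forall>x. k * x $ 1 + l * x $ 2 + (k' * ((*v) A ^^ n) x $ 1 + l' * ((*v) A ^^ n) x $ 2) = 0) \<longrightarrow>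
    c * \<bar>lp\<bar> ^ n \<le> max \<bar>k\<bar> \<bar>l\<bar> * max \<bar>k'\<bar> \<bar>l'\<bar>"
proof -
  have A: "A $ i $ j \<in> \<int>" for i j using assms by (auto simp: anosov_automorphism_def)
  have p: "A *v vp = lp *\<^sub>R vp" "norm vp = 1" and m: "A *v vm = lm *\<^sub>R vm" "norm vm = 1"
    and lpm: "\<bar>lp\<bar> > 1" "1 > \<bar>lm\<bar>"
    using assms by (auto simp: anosov_automorphism_def)
  have p1: "A $ 1 $ 1 * vp $ 1 + A $ 1 $ 2 * vp $ 2 = lp * vp $ 1"
    and p2: "A $ 2 $ 1 * vp $ 1 + A $ 2 $ 2 * vp $ 2 = lp * vp $ 2"
    and m1: "A $ 1 $ 1 * vm $ 1 + A $ 1 $ 2 * vm $ 2 = lm * vm $ 1"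
    and m2: "A $ 2 $ 1 * vm $ 1 + A $ 2 $ 2 * vm $ 2 = lm * vm $ 2"
    using p(1) m(1) by (simp_all add: vec_eq_iff forall_2 matrix_vector_mult_2)
  define J where "J = vp $ 1 * vm $ 2 - vp $ 2 * vm $ 1"
  have J: "J \<noteq> 0" using anosov_eigenvalues(3)[OF assms] by (simp add: J_def)
  have lm0: "lm \<noteq> 0" using anosov_eigenvalues(2)[OF assms] by auto
  have ne: "lp \<noteq> lm" using lpm by auto
  \<comment> \<open>Dictated by the identity \<open>D\<close> below:
    \<open>\<bar>s * t\<bar>\<close> is this constant times the modulus of a nonzero
    integer.\<close>
  define c where "c = \<bar>J\<bar> / \<bar>lm - lp\<bar>"
  have c: "0 < c" using J ne by (simp add: c_def)
  have sep: "c \<le> \<bar>k * vp $ 1 + l * vp $ 2\<bar> * \<bar>k * vm $ 1 + l * vm $ 2\<bar>"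
    if kl: "k \<in> \<int>" "l \<in> \<int>" "(k, l) \<noteq> (0, 0)" for k l
  proof -
    define u where "u = A $ 1 $ 1 * k + A $ 2 $ 1 * l"
    define v where "v = A $ 1 $ 2 * k + A $ 2 $ 2 * l"
    define s where "s = k * vp $ 1 + l * vp $ 2"
    define t where "t = k * vm $ 1 + l * vm $ 2"
    have us: "u * vp $ 1 + v * vp $ 2 = lp * s" and ut: "u * vm $ 1 + v * vm $ 2 = lm * t"
      unfolding u_def v_def s_def t_def using p1 p2 m1 m2 by algebra+
    have D: "(k * v - l * u) * J = (lm - lp) * (s * t)"
      unfolding J_def s_def t_def using us ut unfolding s_def t_def by algebra
    have "k * v - l * u \<noteq> 0"
    proof
      assume "k * v - l * u = 0"
      then have "s = 0 \<or> t = 0" using D ne by simp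
      \<comment> \<open>Take \<open>lp\<close> if \<open>t = 0\<close> and \<open>lm\<close> if
        \<open>s = 0\<close>. Then \<open>(u, v)\<close> and the \<open>\<mu>\<close>-fold of
        \<open>(k, l)\<close> have the same pairings with \<open>vp\<close> and \<open>vm\<close>,
        so \<open>(k, l)\<close> is a lattice eigenvector of the transpose.\<close>
      then have "\<exists>\<mu>\<in>{lp, lm}. u * vp $ 1 + v * vp $ 2 = \<mu> * s \<and> u * vm $ 1 + v * vm $ 2 = \<mu> * t"
        using us ut by auto
      then obtain \<mu> where \<mu>: "\<mu> \<in> {lp, lm}" "u * vp $ 1 + v * vp $ 2 = \<mu> * s" "u * vm $ 1 + v * vm $ 2 = \<mu> * t"
        by blast
      have "(u - \<mu> * k) * J = 0" "(v - \<mu> * l) * J = 0"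
        using \<mu>(2,3) unfolding J_def s_def t_def by algebra+
      then have "u = \<mu> * k" "v = \<mu> * l" using J by auto
      then show False
        using anosov_no_lattice_eigenvector[OF assms \<mu>(1) kl(1,2)] kl(3) unfolding u_def v_def by auto
    qed
    moreover have "k * v - l * u \<in> \<int>" using kl A by (simp add: u_def v_def)
    ultimately have "1 \<le> \<bar>k * v - l * u\<bar>" by (rule Ints_nonzero_abs_ge1[rotated])
    then have "\<bar>J\<bar> * 1 \<le> \<bar>J\<bar> * \<bar>k * v - l * u\<bar>" by (intro mult_left_mono) auto
    also have "\<dots> = \<bar>lm - lp\<bar> * (\<bar>s\<bar> * \<bar>t\<bar>)"
      using arg_cong[OF D, of abs] by (simp add: abs_mult mult.commute)
    finally show ?thesis
      using ne by (simp add: c_def s_def t_def pos_divide_le_eq mult.commute)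
  qed
  have dot: "\<bar>k * v $ 1 + l * v $ 2\<bar> \<le> 2 * max \<bar>k\<bar> \<bar>l\<bar>" if "norm v = 1" for k l and v :: "real^2"
  proof -
    have "\<bar>v $ i\<bar> \<le> 1" for i using component_le_norm_cart[of v i] that by simp
    then have "\<bar>k\<bar> * \<bar>v $ 1\<bar> + \<bar>l\<bar> * \<bar>v $ 2\<bar> \<le> \<bar>k\<bar> * 1 + \<bar>l\<bar> * 1"
      by (intro add_mono mult_left_mono) auto
    moreover have "\<bar>k * v $ 1 + l * v $ 2\<bar> \<le> \<bar>k\<bar> * \<bar>v $ 1\<bar> + \<bar>l\<bar> * \<bar>v $ 2\<bar>"
      using abs_triangle_ineq[of "k * v $ 1" "l * v $ 2"] by (simp add: abs_mult)
    ultimately show ?thesis by linarith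
  qed
  \<comment> \<open>The factor 1 / 4 pays for two applications of \<open>dot\<close>, each of which
    loses a factor 2.\<close>
  have "c / 4 * \<bar>lp\<bar> ^ n \<le> max \<bar>k\<bar> \<bar>l\<bar> * max \<bar>k'\<bar> \<bar>l'\<bar>"
    if kl: "k' \<in> \<int>" "l' \<in> \<int>" "(k', l') \<noteq> (0, 0)"
      and eq: "\<And>x. k * x $ 1 + l * x $ 2 + (k' * ((*v) A ^^ n) x $ 1 + l' * ((*v) A ^^ n) x $ 2) = 0"
    for n k l k' l'
  proof -
    \<comment> \<open>Testing at \<open>vp\<close> shows that the pairing of \<open>(k, l)\<close>
      with \<open>vp\<close> is, up to sign, \<open>lp ^ n\<close> times that of
      \<open>(k', l')\<close>. Multiplied by the pairing of \<open>(k', l')\<close> with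
      \<open>vm\<close>, it falls under the lower bound \<open>sep\<close>.\<close>
    have "k * vp $ 1 + l * vp $ 2 = - (lp ^ n) * (k' * vp $ 1 + l' * vp $ 2)"
      using eq[of vp] unfolding matrix_power_eigenvector[OF p(1)]
      by (simp add: algebra_simps)
    then have *: "\<bar>k * vp $ 1 + l * vp $ 2\<bar> = \<bar>lp\<bar> ^ n * \<bar>k' * vp $ 1 + l' * vp $ 2\<bar>"
      by (simp add: abs_mult power_abs)
    have "c * \<bar>lp\<bar> ^ n \<le> \<bar>k' * vp $ 1 + l' * vp $ 2\<bar> * \<bar>k' * vm $ 1 + l' * vm $ 2\<bar> * \<bar>lp\<bar> ^ n"
      using sep[OF kl] by (intro mult_right_mono) auto
    also have "\<dots> = \<bar>k * vp $ 1 + l * vp $ 2\<bar> * \<bar>k' * vm $ 1 + l' * vm $ 2\<bar>"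
      unfolding * by (simp only: mult_ac)
    also have "\<dots> \<le> (2 * max \<bar>k\<bar> \<bar>l\<bar>) * (2 * max \<bar>k'\<bar> \<bar>l'\<bar>)"
      using p m by (intro mult_mono dot) auto
    finally show ?thesis by simp
  qed
  then show ?thesis using c by (intro exI[of _ "c / 4"]) auto
qed

lemma continuous_on_matrix_power:
  fixes A :: "real^2^2"
  shows "continuous_on S ((*v) A ^^ n)"
proof (induction n)
  case (Suc n)
  then show ?case
    by (auto simp: o_def intro!: linear_continuous_on_compose[OF _ matrix_vector_mul_linear])
qed (simp add: id_def)

text \<open>The entries of \<open>A\<close> are integers, so its transpose maps frequencies to
  frequencies. The new frequency is recorded through its linear form, the shape in which
  \<open>anosov_diophantine\<close> expects a resonance.\<close>

lemma torus_char_matrix_power: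
  assumes "anosov_automorphism A lp lm vp vm"
  shows "\<exists>k' l'. \<forall>x. of_int k * ((*v) A ^^ n) x $ 1 + of_int l * ((*v) A ^^ n) x $ 2 = 
     of_int k' * x $ 1 + of_int l' * x $ 2"
proof (induction n arbitrary: k l)
  case (Suc n)
  have "\<forall>i j. \<exists>z. A $ i $ j = of_int z"
    using assms unfolding anosov_automorphism_def Ints_def by blast
  then obtain B where B: "A $ i $ j = of_int (B i j)" for i j by metis
  from Suc[of "k * B 1 1 + l * B 2 1" "k * B 1 2 + l * B 2 2"] show ?case
    by (simp add: matrix_vector_mult_2 B algebra_simps)
qed auto

text \<open>Both sides are bilinear, so characters suffice. If the second one is not constant, its
  mean is zero, and so is the mean of the product: a resonance would force the Diophantine lower
  bound on a product of frequencies strictly below \<open>R * R'\<close>.\<close>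

lemma cmean_trig_poly_mult:
  assumes "anosov_automorphism A lp lm vp vm"
  shows "\<exists>c>0. \<forall>n R R'. \<forall>p\<in>trig_poly R. \<forall>q\<in>trig_poly R'. R * R' \<le> c * \<bar>lp\<bar> ^ n \<longrightarrow>
     cmean (\<lambda>x. p x * q (((*v) A ^^ n) x)) = cmean p * cmean q"
proof -
  obtain c where c: "0 < c" and dioph: "\<And>n k l k' l'. k' \<in> \<int> \<Longrightarrow> l' \<in> \<int> \<Longrightarrow> (k', l') \<noteq> (0, 0) \<Longrightarrow>
    (\<And>x. k * x $ 1 + l * x $ 2 + (k' * ((*v) A ^^ n) x $ 1 + l' * ((*v) A ^^ n) x $ 2) = 0) \<Longrightarrow>
    c * \<bar>lp\<bar> ^ n \<le> max \<bar>k\<bar> \<bar>l\<bar> * max \<bar>k'\<bar> \<bar>l'\<bar>"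
    using anosov_diophantine[OF assms] by blast
  have "cmean (\<lambda>x. p x * q (((*v) A ^^ n) x)) = cmean p * cmean q"
    if R: "R * R' \<le> c * \<bar>lp\<bar> ^ n" and "p \<in> trig_poly R" "q \<in> trig_poly R'" for n R R' p q
  proof -
    let ?T = "(*v) A ^^ n"
    note contT = continuous_on_compose2[OF continuous_on_trig_poly continuous_on_matrix_power[where S=UNIV]]
    show ?thesis
      using that(2)
    proof induction
      case (scale p d)
      then show ?case by (simp add: cmean_mult mult.assoc)
    next
      case (add p p')
      then show ?case
        unfolding distrib_right using that(3)
        by (subst (1 2) cmean_add) (auto intro!: continuous_on_mult contT simp: distrib_right intro: continuous_on_trig_poly)
    next
      case (torus_char k l)
      note kl = torus_char
      show ?case
        using that(3)
      proof induction
        case (scale q d)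
        then show ?case by (simp add: cmean_mult mult.left_commute)
      next
        case (add q q')
        have "continuous_on UNIV (torus_char k l)"
          using trig_poly.torus_char[OF kl] by (rule continuous_on_trig_poly)
        then show ?case
          unfolding distrib_left using add
          by (subst (1 2) cmean_add) (auto intro!: continuous_on_mult contT simp: distrib_left intro: continuous_on_trig_poly)
      next
        case (torus_char k' l')
        obtain k'' l'' where *: "of_int k' * ?T x $ 1 + of_int l' * ?T x $ 2 = of_int k'' * x $ 1 + of_int l'' * x $ 2" for x
          using torus_char_matrix_power[OF assms, of k' n l'] by blast
        have "(\<lambda>x. torus_char k l x * torus_char k' l' (?T x)) = torus_char (k + k'') (l + l'')"
          by (simp add: torus_char_def fun_eq_iff cis_mult * algebra_simps)
        then have mean: "cmean (\<lambda>x. torus_char k l x * torus_char k' l' (?T x)) = (if k + k'' = 0 \<and> l + l'' = 0 then 1 else 0)"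
          by (simp add: cmean_torus_char)
        show ?case
        proof (cases "k' = 0 \<and> l' = 0")
          case True
          have "of_int k'' = (0::real)" "of_int l'' = (0::real)"
            using *[of "axis 1 1"] *[of "axis 2 1"] True by (simp_all add: axis_def)
          then show ?thesis unfolding mean using True by (simp add: cmean_torus_char)
        next
          case False
          have "\<not> (k + k'' = 0 \<and> l + l'' = 0)"
          proof
            assume kk: "k + k'' = 0 \<and> l + l'' = 0"
            then have kk': "k'' = - k" "l'' = - l" by auto
            have "c * \<bar>lp\<bar> ^ n \<le> max \<bar>of_int k\<bar> \<bar>of_int l\<bar> * max \<bar>of_int k'\<bar> \<bar>of_int l'\<bar>"
              by (rule dioph) (use False in \<open>auto simp: * kk'\<close>)
            also have "\<dots> < R * R'"
            proof -
              have "max \<bar>of_int k\<bar> \<bar>of_int l\<bar> < R" "max \<bar>of_int k'\<bar> \<bar>of_int l'\<bar> < R'"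
                using kl torus_char by auto
              then show ?thesis by (intro mult_strict_mono) auto
            qed
            finally show False using R by simp
          qed
          then show ?thesis unfolding mean using False by (simp add: cmean_torus_char)
        qed
      qed
    qed
  qed
  then show ?thesis using c by blast
qed

subsection \<open>Decay of correlations\<close>

definition torus_corr :: "(real^2 \<Rightarrow> real^2) \<Rightarrow> (real^2 \<Rightarrow> complex) \<Rightarrow> (real^2 \<Rightarrow> complex) \<Rightarrow> complex" where
  "torus_corr T u v = cmean (\<lambda>x. u x * v (T x)) - cmean u * cmean v"

lemma torus_corr_add_left:
  assumes "continuous_on UNIV u" "continuous_on UNIV u'" "continuous_on UNIV v" "continuous_on UNIV T"
  shows "torus_corr T (\<lambda>x. u x + u' x) v = torus_corr T u v + torus_corr T u' v"
proof -
  have "continuous_on UNIV (\<lambda>x. v (T x))" using assms(3,4) by (rule continuous_on_compose2) auto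
  then show ?thesis
    unfolding torus_corr_def distrib_right using assms
    by (subst (1 2) cmean_add) (auto intro!: continuous_on_mult simp: distrib_right)
qed

lemma torus_corr_add_right:
  assumes "continuous_on UNIV u" "continuous_on UNIV v" "continuous_on UNIV v'" "continuous_on UNIV T"
  shows "torus_corr T u (\<lambda>x. v x + v' x) = torus_corr T u v + torus_corr T u v'"
proof -
  have "continuous_on UNIV (\<lambda>x. v (T x))" using assms(2,4) by (rule continuous_on_compose2) auto
  moreover have "continuous_on UNIV (\<lambda>x. v' (T x))" using assms(3,4) by (rule continuous_on_compose2) auto
  ultimately show ?thesis
    unfolding torus_corr_def distrib_left using assms
    by (subst (1 2) cmean_add) (auto intro!: continuous_on_mult simp: distrib_left)
qed

lemma torus_corr_bound:
  assumes "continuous_on UNIV u" "continuous_on UNIV v" "continuous_on UNIV T"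
    and "\<And>x. cmod (u x) \<le> B" "\<And>x. cmod (v x) \<le> D"
  shows "cmod (torus_corr T u v) \<le> 2 * (B * D)"
proof -
  have B: "0 \<le> B" using assms(4)[of 0] norm_ge_zero order_trans by blast
  have "continuous_on UNIV (\<lambda>x. v (T x))" using assms(2,3) by (rule continuous_on_compose2) auto
  then have "cmod (cmean (\<lambda>x. u x * v (T x))) \<le> B * D"
    using assms B by (intro cmean_bound continuous_on_mult) (auto simp: norm_mult intro!: mult_mono)
  moreover have "cmod (cmean u * cmean v) \<le> B * D"
    unfolding norm_mult using assms B by (intro mult_mono cmean_bound) auto
  ultimately show ?thesis
    unfolding torus_corr_def using norm_triangle_ineq4[of "cmean (\<lambda>x. u x * v (T x))" "cmean u * cmean v"]
    by linarith
qed

text \<open>Absorbs the factor \<open>n\<close> from telescoping over \<open>n\<close> scales; the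
  gap between \<open>\<rho>\<close> and \<open>r\<close> is spent here.\<close>

lemma linear_times_power_bound:
  fixes \<rho> r :: real
  assumes "0 \<le> \<rho>" "\<rho> < r"
  shows "\<exists>C>0. \<forall>n. (1 + real n) * \<rho> ^ n \<le> C * r ^ n"
proof -
  have r: "0 < r" using assms by simp
  have x: "norm (\<rho> / r) < 1" using assms by simp
  have "(\<lambda>n. (1 + real n) * (\<rho> / r) ^ n) \<longlonglongrightarrow> 0"
    using tendsto_add[OF LIMSEQ_power_zero[OF x] powser_times_n_limit_0[OF x]]
    by (simp add: distrib_right)
  then have "Bseq (\<lambda>n. (1 + real n) * (\<rho> / r) ^ n)"
    by (intro convergent_imp_Bseq convergentI)
  then obtain C where C: "0 < C" "\<And>n. norm ((1 + real n) * (\<rho> / r) ^ n) \<le> C"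
    by (auto elim: BseqE)
  have "(1 + real n) * \<rho> ^ n \<le> C * r ^ n" for n
  proof -
    have "(1 + real n) * (\<rho> / r) ^ n \<le> C" using C(2)[of n] by (simp add: abs_le_iff)
    then show ?thesis using r by (simp add: power_divide field_simps)
  qed
  then show ?thesis using C(1) by blast
qed

lemma holder_continuous_on:
  fixes f :: "'a::real_normed_vector \<Rightarrow> real"
  assumes holder: "\<And>x y. \<bar>f x - f y\<bar> \<le> L * norm (x - y) powr \<alpha>" and "0 < \<alpha>"
  shows "continuous_on S f"
  unfolding continuous_on_def
proof
  fix x assume "x \<in> S"
  have "((\<lambda>y. L * norm (y - x) powr \<alpha>) \<longlongrightarrow> L * 0 powr \<alpha>) (at x within S)"
    by (intro tendsto_intros tendsto_powr2 tendsto_norm_zero LIM_zero tendsto_ident_at) (auto simp: assms(2))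
  then have "((\<lambda>y. L * norm (y - x) powr \<alpha>) \<longlongrightarrow> 0) (at x within S)" by simp
  then have "((\<lambda>y. f y - f x) \<longlongrightarrow> 0) (at x within S)"
    by (rule Lim_null_comparison[rotated]) (simp add: holder)
  then show "(f \<longlongrightarrow> f x) (at x within S)" by (rule LIM_zero_cancel)
qed

text \<open>
  Telescope \<open>f\<close> along trigonometric approximations of degree \<open>\<bar>lp\<bar> ^ i\<close>.  The \<open>i\<close>-th increment is
  uncorrelated with every polynomial of degree \<open>c * \<bar>lp\<bar> ^ (n - i)\<close>, so \<open>g\<close> may be replaced there by its
  approximation error, and each increment contributes \<open>O(\<bar>lp\<bar> powr (- \<alpha> * n))\<close>.
\<close>

theorem anosov_correlation_decay:
  assumes "anosov_automorphism A lp lm vp vm" "0 < \<alpha>" "\<alpha> \<le> 1" "\<bar>lp\<bar> powr (- \<alpha>) < r"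
  obtains C where "\<And>f g M L M' L' n. torus_fun f \<Longrightarrow> torus_fun g \<Longrightarrow>
    (\<And>x. \<bar>f x\<bar> \<le> M) \<Longrightarrow> (\<And>x y. \<bar>f x - f y\<bar> \<le> L * norm (x - y) powr \<alpha>) \<Longrightarrow> 0 \<le> L \<Longrightarrow>
    (\<And>x. \<bar>g x\<bar> \<le> M') \<Longrightarrow> (\<And>x y. \<bar>g x - g y\<bar> \<le> L' * norm (x - y) powr \<alpha>) \<Longrightarrow> 0 \<le> L' \<Longrightarrow>
    \<bar>torus_mean (\<lambda>x. f x * g (((*v) A ^^ n) x)) - torus_mean f * torus_mean g\<bar>
      \<le> C * (M + L) * (M' + L') * r ^ n"
proof -
  define \<rho> where "\<rho> = \<bar>lp\<bar> powr (- \<alpha>)"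
  have lp: "1 < \<bar>lp\<bar>" using assms(1) by (simp add: anosov_automorphism_def)
  then have \<rho>: "0 < \<rho>" by (simp add: \<rho>_def)
  have pow: "(\<bar>lp\<bar> ^ i) powr (- \<alpha>) = \<rho> ^ i" for i
  proof -
    have "(\<bar>lp\<bar> ^ i) powr (- \<alpha>) = (\<bar>lp\<bar> powr real i) powr (- \<alpha>)"
      using lp by (simp add: powr_realpow)
    also have "\<dots> = (\<bar>lp\<bar> powr (- \<alpha>)) powr real i"
      by (simp add: powr_powr mult.commute)
    finally show ?thesis using \<rho> by (simp add: \<rho>_def powr_realpow)
  qed
  obtain c where c: "0 < c" and uncorr: "\<And>n R R' p q. p \<in> trig_poly R \<Longrightarrow> q \<in> trig_poly R' \<Longrightarrow>
      R * R' \<le> c * \<bar>lp\<bar> ^ n \<Longrightarrow> cmean (\<lambda>x. p x * q (((*v) A ^^ n) x)) = cmean p * cmean q"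
    using cmean_trig_poly_mult[OF assms(1)] by blast
  \<comment> \<open>The loss in accuracy from degrees \<open>c * \<bar>lp\<bar> ^ i\<close> in place
    of \<open>\<bar>lp\<bar> ^ i\<close>.\<close>
  define k where "k = c powr (- \<alpha>)"
  have k: "0 < k" using c by (simp add: k_def)
  obtain C where C: "0 < C" "\<And>n. (1 + real n) * \<rho> ^ n \<le> C * r ^ n"
    using linear_times_power_bound[of \<rho> r] \<rho> assms(4) by (auto simp: \<rho>_def)
  \<comment> \<open>The terms are the costs of the remainder \<open>f - p n\<close>, of the coarsest
    polynomial \<open>p 0\<close>, and of a single increment. The increment
    \<open>p (Suc i) - p i\<close> has degree \<open>\<bar>lp\<bar> ^ Suc i\<close>, which leaves
    one power less to its partner; hence the division by \<open>\<rho>\<close>.\<close>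
  define K where "K = 2 + 4 * k + 4 * (k / \<rho>)"
  have K: "0 \<le> K" using k \<rho> by (simp add: K_def)
  have main: "\<bar>torus_mean (\<lambda>x. f x * g (((*v) A ^^ n) x)) - torus_mean f * torus_mean g\<bar>
      \<le> 514\<^sup>2 * K * C * (M + L) * (M' + L') * r ^ n"
    if "torus_fun f" "torus_fun g"
      and f': "\<And>x. \<bar>f x\<bar> \<le> M" "\<And>x y. \<bar>f x - f y\<bar> \<le> L * norm (x - y) powr \<alpha>" "0 \<le> L"
      and g': "\<And>x. \<bar>g x\<bar> \<le> M'" "\<And>x y. \<bar>g x - g y\<bar> \<le> L' * norm (x - y) powr \<alpha>" "0 \<le> L'"
    for f g M L M' L' n
  proof -
    note f = that(1) f' and g = that(2) g'
    let ?T = "(*v) A ^^ n"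
    define Ef where "Ef = 514 * (M + L)"
    define Eg where "Eg = 514 * (M' + L')"
    have "0 \<le> M" "0 \<le> M'" using f(2)[of 0] g(2)[of 0] by linarith+
    then have Ef: "0 \<le> Ef" "M \<le> Ef" and Eg: "0 \<le> Eg" "M' \<le> Eg"
      using f(4) g(4) by (auto simp: Ef_def Eg_def)
    have "\<exists>p\<in>trig_poly (\<bar>lp\<bar> ^ i). \<forall>x. cmod (p x - of_real (f x)) \<le> Ef * \<rho> ^ i" for i
      using trig_poly_approx[OF f(1-3) assms(2,3) f(4), of "\<bar>lp\<bar> ^ i"] lp
      by (simp add: Ef_def pow)
    then obtain p where p: "\<And>i. p i \<in> trig_poly (\<bar>lp\<bar> ^ i)" "\<And>i x. cmod (p i x - of_real (f x)) \<le> Ef * \<rho> ^ i"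
      by metis
    have "\<exists>q\<in>trig_poly (c * \<bar>lp\<bar> ^ i). \<forall>x. cmod (q x - of_real (g x)) \<le> Eg * (k * \<rho> ^ i)" for i
      using trig_poly_approx[OF g(1-3) assms(2,3) g(4), of "c * \<bar>lp\<bar> ^ i"] lp c
      by (simp add: Eg_def powr_mult pow k_def)
    then obtain q where q: "\<And>i. q i \<in> trig_poly (c * \<bar>lp\<bar> ^ i)"
        "\<And>i x. cmod (q i x - of_real (g x)) \<le> Eg * (k * \<rho> ^ i)"
      by metis
    let ?f = "\<lambda>x. complex_of_real (f x)" and ?g = "\<lambda>x. complex_of_real (g x)"
    have contr: "continuous_on UNIV f" "continuous_on UNIV g"
      using holder_continuous_on[OF f(3) assms(2)] holder_continuous_on[OF g(3) assms(2)] by auto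
    have cont: "continuous_on UNIV ?f" "continuous_on UNIV ?g" "continuous_on UNIV (p i)"
      "continuous_on UNIV (q i)" "continuous_on UNIV ?T" for i
      using contr p(1) q(1)
      by (auto intro!: continuous_on_of_real continuous_on_matrix_power intro: continuous_on_trig_poly)
    have high: "cmod (torus_corr ?T u ?g) \<le> 2 * (B * (Eg * (k * \<rho> ^ j)))"
      if u: "u \<in> trig_poly (\<bar>lp\<bar> ^ i)" "\<And>x. cmod (u x) \<le> B" "i + j = n" for u i j B
    proof -
      have "torus_corr ?T u (q j) = 0"
        using uncorr[OF u(1) q(1)[of j], of n] u(3) by (simp add: torus_corr_def mult_ac flip: power_add)
      moreover have "torus_corr ?T u (\<lambda>x. (?g x - q j x) + q j x)
          = torus_corr ?T u (\<lambda>x. ?g x - q j x) + torus_corr ?T u (q j)"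
        using u(1) cont by (intro torus_corr_add_right continuous_intros) (auto intro: continuous_on_trig_poly)
      ultimately have "torus_corr ?T u ?g = torus_corr ?T u (\<lambda>x. ?g x - q j x)" by simp
      also have "cmod \<dots> \<le> 2 * (B * (Eg * (k * \<rho> ^ j)))"
        using u(1,2) cont q(2)
        by (intro torus_corr_bound continuous_intros)
          (auto intro: continuous_on_trig_poly simp: norm_minus_commute)
      finally show ?thesis .
    qed
    have p0: "cmod (p 0 x) \<le> 2 * Ef" for x
    proof -
      have "cmod (p 0 x) \<le> cmod (p 0 x - ?f x) + cmod (?f x)" using norm_triangle_ineq[of "p 0 x - ?f x" "?f x"] by simp
      also have "\<dots> \<le> Ef + M" using p(2)[of 0 x] f(2)[of x] by simp
      finally show ?thesis using Ef by simp
    qed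
    have dp: "cmod (p (Suc i) x - p i x) \<le> 2 * Ef * \<rho> ^ i" for i x
    proof -
      have "\<rho> \<le> 1" using powr_mono[of "- \<alpha>" 0 "\<bar>lp\<bar>"] lp assms(2)
        by (auto simp: \<rho>_def split: if_splits)
      have "cmod (p (Suc i) x - p i x) \<le> cmod (p (Suc i) x - ?f x) + cmod (p i x - ?f x)"
        using norm_triangle_ineq4[of "p (Suc i) x - ?f x" "p i x - ?f x"] by simp
      also have "\<dots> \<le> Ef * \<rho> ^ Suc i + Ef * \<rho> ^ i" by (intro add_mono p)
      also have "\<rho> ^ Suc i \<le> \<rho> ^ i" using \<rho> \<open>\<rho> \<le> 1\<close> by (simp add: mult_left_le_one_le)
      finally show ?thesis using Ef by (simp add: mult_left_mono)
    qed
    have tele: "cmod (torus_corr ?T (p m) ?g) \<le> 4 * Ef * Eg * \<rho> ^ n * (k + real m * (k / \<rho>))"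
      if "m \<le> n" for m
      using that
    proof (induction m)
      case 0
      then show ?case using high[of "p 0" 0 "2 * Ef" n] p(1)[of 0] p0 by (simp add: mult_ac)
    next
      case (Suc m)
      have "torus_corr ?T (\<lambda>x. (p (Suc m) x - p m x) + p m x) ?g
          = torus_corr ?T (\<lambda>x. p (Suc m) x - p m x) ?g + torus_corr ?T (p m) ?g"
        using cont by (intro torus_corr_add_left continuous_intros) auto
      then have "cmod (torus_corr ?T (p (Suc m)) ?g) \<le> cmod (torus_corr ?T (\<lambda>x. p (Suc m) x - p m x) ?g)
          + cmod (torus_corr ?T (p m) ?g)"
        by (simp add: norm_triangle_ineq)
      moreover have "cmod (torus_corr ?T (\<lambda>x. p (Suc m) x - p m x) ?g)
          \<le> 2 * (2 * Ef * \<rho> ^ m * (Eg * (k * \<rho> ^ (n - Suc m))))"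
      proof (rule high)
        show "(\<lambda>x. p (Suc m) x - p m x) \<in> trig_poly (\<bar>lp\<bar> ^ Suc m)"
          using lp by (intro trig_poly_diff p trig_poly_mono[OF p(1)[of m]]) (simp add: mult_le_cancel_right1)
      qed (use dp Suc in auto)
      moreover have "\<rho> ^ m * \<rho> ^ (n - Suc m) = \<rho> ^ n / \<rho>"
      proof -
        have "\<rho> * (\<rho> ^ m * \<rho> ^ (n - Suc m)) = \<rho> ^ (Suc m + (n - Suc m))" by (simp add: power_add)
        also have "Suc m + (n - Suc m) = n" using Suc by simp
        finally show ?thesis using \<rho> by (simp add: field_simps)
      qed
      then have "2 * (2 * Ef * \<rho> ^ m * (Eg * (k * \<rho> ^ (n - Suc m)))) = 4 * Ef * Eg * k * (\<rho> ^ n / \<rho>)"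
        by (simp add: mult_ac)
      ultimately show ?case using Suc by (simp add: algebra_simps)
    qed
    \<comment> \<open>The remainder \<open>f - p n\<close> is already of size
      \<open>\<rho> ^ n\<close>, so the crude bound on correlations suffices for it.\<close>
    have "torus_corr ?T (\<lambda>x. (?f x - p n x) + p n x) ?g
        = torus_corr ?T (\<lambda>x. ?f x - p n x) ?g + torus_corr ?T (p n) ?g"
      using cont by (intro torus_corr_add_left continuous_intros) auto
    then have "cmod (torus_corr ?T ?f ?g) \<le> cmod (torus_corr ?T (\<lambda>x. ?f x - p n x) ?g)
        + cmod (torus_corr ?T (p n) ?g)"
      by (simp add: norm_triangle_ineq)
    also have "\<dots> \<le> 2 * (Ef * \<rho> ^ n * Eg) + 4 * Ef * Eg * \<rho> ^ n * (k + real n * (k / \<rho>))"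
    proof (intro add_mono tele order_refl torus_corr_bound)
      show "cmod (?f x - p n x) \<le> Ef * \<rho> ^ n" for x using p(2)[of n x] by (simp add: norm_minus_commute)
      show "cmod (?g x) \<le> Eg" for x using g(2)[of x] Eg by simp
    qed (use cont in \<open>auto intro!: continuous_intros\<close>)
    also have "\<dots> = Ef * Eg * \<rho> ^ n * (2 + 4 * k + real n * (4 * (k / \<rho>)))"
      by (simp add: algebra_simps)
    also have "\<dots> \<le> Ef * Eg * \<rho> ^ n * (K * (1 + real n))"
    proof (intro mult_left_mono)
      have pos: "2 + 4 * k + real n * (4 * x) \<le> (2 + 4 * k + 4 * x) * (1 + real n)" if "0 \<le> x" for x
        using k that by (simp add: algebra_simps)
      from k \<rho> have "0 \<le> k / \<rho>" by simp
      then show "2 + 4 * k + real n * (4 * (k / \<rho>)) \<le> K * (1 + real n)"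
        unfolding K_def by (rule pos)
    qed (use Ef Eg \<rho> in auto)
    also have "\<dots> = Ef * Eg * K * ((1 + real n) * \<rho> ^ n)" by (simp only: mult_ac)
    also have "\<dots> \<le> Ef * Eg * K * (C * r ^ n)"
      using Ef Eg K C(2) by (intro mult_left_mono) auto
    also have "\<dots> = 514\<^sup>2 * K * C * (M + L) * (M' + L') * r ^ n"
      by (simp only: Ef_def Eg_def power2_eq_square mult_ac)
    finally have "cmod (torus_corr ?T ?f ?g) \<le> 514\<^sup>2 * K * C * (M + L) * (M' + L') * r ^ n" .
    moreover have "torus_corr ?T ?f ?g = of_real (torus_mean (\<lambda>x. f x * g (?T x)) - torus_mean f * torus_mean g)"
    proof -
      have "continuous_on UNIV (\<lambda>x. f x * g (?T x))"
        using contr cont(5) by (intro continuous_on_mult continuous_on_compose2[of UNIV g UNIV ?T]) auto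
      then have "cmean (\<lambda>x. of_real (f x * g (?T x))) = of_real (torus_mean (\<lambda>x. f x * g (?T x)))"
        by (rule cmean_of_real)
      then show ?thesis
        by (simp add: torus_corr_def cmean_of_real contr)
    qed
    ultimately show ?thesis by (simp only: norm_of_real)
  qed
  show ?thesis by (rule that[OF main])
qed

subsection \<open>Hoelder function spaces\<close>

text \<open>Finiteness matters: \<open>enn2real\<close> sends infinity to 0, where the bound would
  fail.\<close>

lemma le_enn2realI: "ennreal x \<le> t \<Longrightarrow> t < \<infinity> \<Longrightarrow> x \<le> enn2real t"
  by (cases t) (auto simp: ennreal_le_iff2)

lemma abs_le_sup_norm: "x \<in> D \<Longrightarrow> ennreal \<bar>g x\<bar> \<le> sup_norm D g"
  unfolding sup_norm_def by (rule SUP_upper)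

lemma le_holder_seminorm:
  assumes "\<phi> \<in> U" "\<psi> \<noteq> \<psi>'"
  shows "ennreal (\<bar>g (\<phi>, \<psi>') - g (\<phi>, \<psi>)\<bar> / norm (\<psi>' - \<psi>) powr \<alpha>) \<le> holder_seminorm U \<alpha> g"
  unfolding holder_seminorm_def
  by (rule SUP_upper2[OF assms(1)], rule SUP_upper2[of "(\<psi>, \<psi>')"]) (use assms in auto)

text \<open>Both norms carry the seminorm with weight \<open>\<alpha>\<close>, hence the quotient.
  The bound \<open>t\<close> is left free so that the lemma serves \<open>holder_norm\<close> and
  \<open>B_norm\<close> alike.\<close>

lemma holder_seminorm_bound:
  assumes "ennreal \<alpha> * holder_seminorm U \<alpha> g \<le> t" "t < \<infinity>" "0 < \<alpha>" "\<phi> \<in> U"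
  shows "\<bar>g (\<phi>, \<psi>') - g (\<phi>, \<psi>)\<bar> \<le> enn2real t / \<alpha> * norm (\<psi>' - \<psi>) powr \<alpha>"
proof (cases "\<psi> = \<psi>'")
  case False
  let ?q = "\<bar>g (\<phi>, \<psi>') - g (\<phi>, \<psi>)\<bar> / norm (\<psi>' - \<psi>) powr \<alpha>"
  have "ennreal (\<alpha> * ?q) = ennreal \<alpha> * ennreal ?q" using assms by (intro ennreal_mult) auto
  also have "\<dots> \<le> ennreal \<alpha> * holder_seminorm U \<alpha> g"
    using assms False by (intro mult_left_mono le_holder_seminorm) auto
  also have "\<dots> \<le> t" by (rule assms)
  finally have "\<alpha> * ?q \<le> enn2real t" using assms(2) by (rule le_enn2realI)
  then show ?thesis using assms False by (simp add: field_simps)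
qed simp

lemma holder_norm_bounds:
  assumes "holder_norm U \<alpha> g < \<infinity>" "0 < \<alpha>" "\<phi> \<in> U"
  shows "\<bar>g (\<phi>, \<psi>)\<bar> \<le> enn2real (holder_norm U \<alpha> g)"
    and "\<bar>g (\<phi>, \<psi>') - g (\<phi>, \<psi>)\<bar> \<le> enn2real (holder_norm U \<alpha> g) / \<alpha> * norm (\<psi>' - \<psi>) powr \<alpha>"
proof -
  show "\<bar>g (\<phi>, \<psi>)\<bar> \<le> enn2real (holder_norm U \<alpha> g)"
    using assms abs_le_sup_norm[of "(\<phi>, \<psi>)" "U \<times> UNIV" g]
    by (intro le_enn2realI) (auto simp: holder_norm_def add_increasing2)
  show "\<bar>g (\<phi>, \<psi>') - g (\<phi>, \<psi>)\<bar> \<le> enn2real (holder_norm U \<alpha> g) / \<alpha> * norm (\<psi>' - \<psi>) powr \<alpha>"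
    using assms by (intro holder_seminorm_bound) (auto simp: holder_norm_def add_increasing)
qed

lemma B_norm_bounds:
  assumes "g \<in> B_space U \<alpha> k" "0 < \<alpha>" "\<phi> \<in> U"
  shows "n \<le> k \<Longrightarrow> \<bar>(dphi U ^^ n) g (\<phi>, \<psi>)\<bar> \<le> enn2real (B_norm U \<alpha> k g)"
    and "n < k \<Longrightarrow> \<bar>(dphi U ^^ n) g (\<phi>, \<psi>') - (dphi U ^^ n) g (\<phi>, \<psi>)\<bar>
       \<le> enn2real (B_norm U \<alpha> k g) / \<alpha> * norm (\<psi>' - \<psi>) powr \<alpha>"
proof -
  have fin: "B_norm U \<alpha> k g < \<infinity>" using assms(1) by (simp add: B_space_def)
  show "\<bar>(dphi U ^^ n) g (\<phi>, \<psi>)\<bar> \<le> enn2real (B_norm U \<alpha> k g)" if "n \<le> k"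
  proof (rule le_enn2realI[OF _ fin])
    have "ennreal \<bar>(dphi U ^^ n) g (\<phi>, \<psi>)\<bar> \<le> sup_norm (U \<times> UNIV) ((dphi U ^^ n) g)"
      using assms by (intro abs_le_sup_norm) auto
    also have "\<dots> \<le> (\<Sum>n\<le>k. sup_norm (U \<times> UNIV) ((dphi U ^^ n) g))"
      using that by (intro member_le_sum) auto
    finally show "ennreal \<bar>(dphi U ^^ n) g (\<phi>, \<psi>)\<bar> \<le> B_norm U \<alpha> k g"
      by (simp add: B_norm_def add_increasing2)
  qed
  show "\<bar>(dphi U ^^ n) g (\<phi>, \<psi>') - (dphi U ^^ n) g (\<phi>, \<psi>)\<bar>
       \<le> enn2real (B_norm U \<alpha> k g) / \<alpha> * norm (\<psi>' - \<psi>) powr \<alpha>" if "n < k"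
  proof (rule holder_seminorm_bound[OF _ fin assms(2,3)])
    have "ennreal \<alpha> * holder_seminorm U \<alpha> ((dphi U ^^ n) g)
        \<le> ennreal \<alpha> * (\<Sum>n<k. holder_seminorm U \<alpha> ((dphi U ^^ n) g))"
      using that by (intro mult_left_mono member_le_sum) auto
    then show "ennreal \<alpha> * holder_seminorm U \<alpha> ((dphi U ^^ n) g) \<le> B_norm U \<alpha> k g"
      by (simp add: B_norm_def add_increasing)
  qed
qed

lemma holder_norm_le_B_norm:
  assumes "1 \<le> k"
  shows "holder_norm U \<alpha> g \<le> B_norm U \<alpha> k g"
proof -
  have "sup_norm (U \<times> UNIV) ((dphi U ^^ 0) g) \<le> (\<Sum>n\<le>k. sup_norm (U \<times> UNIV) ((dphi U ^^ n) g))"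
    by (intro member_le_sum) auto
  moreover have "holder_seminorm U \<alpha> ((dphi U ^^ 0) g) \<le> (\<Sum>n<k. holder_seminorm U \<alpha> ((dphi U ^^ n) g))"
    using assms by (intro member_le_sum) auto
  ultimately show ?thesis
    unfolding holder_norm_def B_norm_def by (intro add_mono mult_left_mono) auto
qed

lemma B_space_has_derivative:
  assumes "g \<in> B_space U \<alpha> k" "n < k" "\<phi> \<in> U"
  shows "((\<lambda>t. (dphi U ^^ n) g (t, \<psi>)) has_real_derivative (dphi U ^^ Suc n) g (\<phi>, \<psi>)) (at \<phi> within U)"
proof -
  have "(\<lambda>t. (dphi U ^^ n) g (t, \<psi>)) differentiable (at \<phi> within U)"
    using assms by (simp add: B_space_def)
  then show ?thesis
    by (simp add: dphi_def vector_derivative_works has_real_derivative_iff_has_vector_derivative)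
qed

lemma B_space_lipschitz:
  assumes "g \<in> B_space U \<alpha> k" "0 < \<alpha>" "convex U" "n < k" "\<phi> \<in> U" "\<phi>' \<in> U"
  shows "\<bar>(dphi U ^^ n) g (\<phi>, \<psi>) - (dphi U ^^ n) g (\<phi>', \<psi>)\<bar> \<le> enn2real (B_norm U \<alpha> k g) * \<bar>\<phi> - \<phi>'\<bar>"
  using field_differentiable_bound[OF assms(3) B_space_has_derivative[OF assms(1,4)]
      B_norm_bounds(1)[OF assms(1,2), of _ "Suc n", folded real_norm_def] assms(5,6)] assms(4) by simp

text \<open>The space itself asks for continuity in \<open>\<phi>\<close> only. Joint continuity
  comes from a Lipschitz bound in \<open>\<phi>\<close> uniform in \<open>\<psi>\<close>, given by
  the next derivative, and the Hoelder bound in \<open>\<psi>\<close>; both are available below the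
  top order.\<close>

lemma B_space_continuous_on:
  assumes "g \<in> B_space U \<alpha> k" "0 < \<alpha>" "convex U" "n < k"
  shows "continuous_on (U \<times> UNIV) ((dphi U ^^ n) g)"
  unfolding continuous_on_def
proof
  fix p assume "p \<in> U \<times> (UNIV :: (real^2) set)"
  then obtain \<phi> \<psi> where p: "p = (\<phi>, \<psi>)" "\<phi> \<in> U" by auto
  let ?h = "(dphi U ^^ n) g" and ?N = "enn2real (B_norm U \<alpha> k g)" and ?F = "at p within U \<times> UNIV"
  have "((\<lambda>q. ?N * \<bar>fst q - fst p\<bar> + ?N / \<alpha> * norm (snd q - snd p) powr \<alpha>) \<longlongrightarrow>
      ?N * \<bar>fst p - fst p\<bar> + ?N / \<alpha> * norm (snd p - snd p) powr \<alpha>) ?F"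
    by (intro tendsto_intros tendsto_powr2) (auto simp: assms(2))
  then have lim: "((\<lambda>q. ?N * \<bar>fst q - fst p\<bar> + ?N / \<alpha> * norm (snd q - snd p) powr \<alpha>) \<longlongrightarrow> 0) ?F"
    by simp
  have "\<bar>?h q - ?h p\<bar> \<le> ?N * \<bar>fst q - fst p\<bar> + ?N / \<alpha> * norm (snd q - snd p) powr \<alpha>"
    if "q \<in> U \<times> UNIV" for q
  proof -
    obtain \<phi>' \<psi>' where q: "q = (\<phi>', \<psi>')" "\<phi>' \<in> U" using \<open>q \<in> U \<times> UNIV\<close> by auto
    show ?thesis
      using B_space_lipschitz[OF assms q(2) p(2), of \<psi>] B_norm_bounds(2)[OF assms(1,2) q(2) assms(4), of \<psi>' \<psi>]
      unfolding p q by simp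
  qed
  then have "((\<lambda>q. ?h q - ?h p) \<longlongrightarrow> 0) ?F"
    by (intro Lim_null_comparison[OF _ lim]) (auto simp: eventually_at_filter)
  then show "(?h \<longlongrightarrow> ?h p) ?F" by (rule LIM_zero_cancel)
qed

section \<open>Isotropic Hoelder regularity of the invariant graph\<close>

lemma B_star_directional_holder:
  assumes "W \<in> B_star vm vp \<alpha>m \<alpha>p" "0 < \<alpha>m" "0 < \<alpha>p"
  shows "\<exists>D\<ge>0. \<forall>\<psi> x. \<bar>W (\<psi> + x *\<^sub>R vm) - W \<psi>\<bar> \<le> D * \<bar>x\<bar> powr \<alpha>m \<and>
     \<bar>W (\<psi> + x *\<^sub>R vp) - W \<psi>\<bar> \<le> D * \<bar>x\<bar> powr \<alpha>p"
proof -
  have dir: "\<bar>W (\<psi> + x *\<^sub>R v) - W \<psi>\<bar> \<le> enn2real (dir_seminorm v \<beta> W) * \<bar>x\<bar> powr \<beta>"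
    if "dir_seminorm v \<beta> W < \<infinity>" for v \<beta> \<psi> x
  proof (cases "x = 0")
    case False
    have "ennreal (\<bar>W (\<psi> + x *\<^sub>R v) - W \<psi>\<bar> / \<bar>x\<bar> powr \<beta>) \<le> dir_seminorm v \<beta> W"
      unfolding dir_seminorm_def
      by (rule SUP_upper2[of \<psi>], simp, rule SUP_upper2[of x]) (use False in auto)
    then have "\<bar>W (\<psi> + x *\<^sub>R v) - W \<psi>\<bar> / \<bar>x\<bar> powr \<beta> \<le> enn2real (dir_seminorm v \<beta> W)"
      using that by (rule le_enn2realI)
    then show ?thesis using False by (simp add: pos_divide_le_eq)
  qed simp
  \<comment> \<open>Positivity of the exponents enters here: with weight 0 the convention
    \<open>0 * \<infinity> = 0\<close> would hide an infinite seminorm.\<close>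
  have "dir_seminorm vm \<alpha>m W < \<infinity>" "dir_seminorm vp \<alpha>p W < \<infinity>"
    using assms by (auto simp: B_star_def ennreal_mult_less_top)
  note dir = dir[OF this(1)] dir[OF this(2)]
  let ?D = "enn2real (dir_seminorm vm \<alpha>m W) + enn2real (dir_seminorm vp \<alpha>p W)"
  show ?thesis
  proof (intro exI[of _ ?D] conjI allI)
    show "\<bar>W (\<psi> + x *\<^sub>R vm) - W \<psi>\<bar> \<le> ?D * \<bar>x\<bar> powr \<alpha>m" for \<psi> x
      by (rule order_trans[OF dir(1)]) (simp add: mult_right_mono)
    show "\<bar>W (\<psi> + x *\<^sub>R vp) - W \<psi>\<bar> \<le> ?D * \<bar>x\<bar> powr \<alpha>p" for \<psi> x
      by (rule order_trans[OF dir(2)]) (simp add: mult_right_mono)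
  qed simp
qed

text \<open>Cramer's rule in the eigenbasis, with determinant \<open>J\<close>. Taking
  \<open>\<kappa>\<close> at least 1 makes \<open>\<kappa> powr \<beta> \<le> \<kappa>\<close> for
  exponents up to 1.\<close>

lemma anosov_decompose:
  assumes "anosov_automorphism A lp lm vp vm"
  shows "\<exists>\<kappa>\<ge>1. \<forall>h. \<exists>x y. h = x *\<^sub>R vp + y *\<^sub>R vm \<and> \<bar>x\<bar> \<le> \<kappa> * norm h \<and> \<bar>y\<bar> \<le> \<kappa> * norm h"
proof -
  define J where "J = vp $ 1 * vm $ 2 - vp $ 2 * vm $ 1"
  have J: "J \<noteq> 0" using anosov_eigenvalues(3)[OF assms] by (simp add: J_def)
  have n: "norm vp = 1" "norm vm = 1" using assms by (auto simp: anosov_automorphism_def)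
  have b: "\<bar>h $ i * v $ j - h $ j * v $ i\<bar> \<le> 2 * norm h" if "norm v = 1" for h v :: "real^2" and i j
  proof -
    have "\<bar>h $ i\<bar> * \<bar>v $ j\<bar> \<le> norm h * 1" for i j
      using component_le_norm_cart[of h i] component_le_norm_cart[of v j] that by (intro mult_mono) auto
    from this[of i j] this[of j i] show ?thesis
      using abs_triangle_ineq4[of "h $ i * v $ j" "h $ j * v $ i"] by (simp add: abs_mult)
  qed
  define \<kappa> where "\<kappa> = max 1 (2 / \<bar>J\<bar>)"
  have "\<exists>x y. h = x *\<^sub>R vp + y *\<^sub>R vm \<and> \<bar>x\<bar> \<le> \<kappa> * norm h \<and> \<bar>y\<bar> \<le> \<kappa> * norm h" for h
  proof (intro exI conjI)
    let ?x = "(h $ 1 * vm $ 2 - h $ 2 * vm $ 1) / J" and ?y = "(h $ 2 * vp $ 1 - h $ 1 * vp $ 2) / J"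
    have "h $ 1 * J = (h $ 1 * vm $ 2 - h $ 2 * vm $ 1) * vp $ 1 + (h $ 2 * vp $ 1 - h $ 1 * vp $ 2) * vm $ 1"
      "h $ 2 * J = (h $ 1 * vm $ 2 - h $ 2 * vm $ 1) * vp $ 2 + (h $ 2 * vp $ 1 - h $ 1 * vp $ 2) * vm $ 2"
      unfolding J_def by algebra+
    then show "h = ?x *\<^sub>R vp + ?y *\<^sub>R vm"
      using J by (simp add: vec_eq_iff forall_2 add_divide_distrib[symmetric] nonzero_eq_divide_eq)
    have \<kappa>: "z / \<bar>J\<bar> \<le> \<kappa> * norm h" if "z \<le> 2 * norm h" for z
    proof -
      have "z / \<bar>J\<bar> \<le> 2 / \<bar>J\<bar> * norm h" using that J by (simp add: divide_right_mono)
      also have "\<dots> \<le> \<kappa> * norm h" by (intro mult_right_mono) (auto simp: \<kappa>_def)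
      finally show ?thesis .
    qed
    show "\<bar>?x\<bar> \<le> \<kappa> * norm h" "\<bar>?y\<bar> \<le> \<kappa> * norm h"
      unfolding abs_divide by (intro \<kappa> b n)+
  qed
  then show ?thesis by (intro exI[of _ \<kappa>]) (auto simp: \<kappa>_def)
qed

text \<open>Go from \<open>y\<close> to \<open>x\<close> first along \<open>vp\<close>, then along
  \<open>vm\<close>. At distance at most 1 both directional exponents may be lowered to
  \<open>\<alpha>\<close>; at larger distances the bound \<open>2 * M\<close> is enough.\<close>

lemma B_star_holder:
  assumes "anosov_automorphism A lp lm vp vm" "W \<in> B_star vm vp \<alpha>m \<alpha>p"
    and "0 < \<alpha>" "\<alpha> \<le> \<alpha>m" "\<alpha>m \<le> 1" "\<alpha> \<le> \<alpha>p" "\<alpha>p \<le> 1" and bound: "\<And>\<psi>. \<bar>W \<psi>\<bar> \<le> M"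
  shows "\<exists>D\<ge>0. \<forall>x y. \<bar>W x - W y\<bar> \<le> D * norm (x - y) powr \<alpha>"
proof -
  obtain D where D: "0 \<le> D" "\<And>\<psi> x. \<bar>W (\<psi> + x *\<^sub>R vm) - W \<psi>\<bar> \<le> D * \<bar>x\<bar> powr \<alpha>m"
     "\<And>\<psi> x. \<bar>W (\<psi> + x *\<^sub>R vp) - W \<psi>\<bar> \<le> D * \<bar>x\<bar> powr \<alpha>p"
    using B_star_directional_holder[OF assms(2)] assms by auto
  obtain \<kappa> where \<kappa>: "1 \<le> \<kappa>" "\<And>h. \<exists>x y. h = x *\<^sub>R vp + y *\<^sub>R vm \<and> \<bar>x\<bar> \<le> \<kappa> * norm h \<and> \<bar>y\<bar> \<le> \<kappa> * norm h"
    using anosov_decompose[OF assms(1)] by blast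
  have M: "0 \<le> M" using bound[of 0] by linarith
  have "\<bar>W x - W y\<bar> \<le> (2 * M + 2 * D * \<kappa>) * norm (x - y) powr \<alpha>" for x y
  proof (cases "norm (x - y) \<le> 1")
    case True
    obtain s t where st: "x - y = s *\<^sub>R vp + t *\<^sub>R vm" "\<bar>s\<bar> \<le> \<kappa> * norm (x - y)" "\<bar>t\<bar> \<le> \<kappa> * norm (x - y)"
      using \<kappa>(2) by blast
    have pow: "\<bar>s\<bar> powr \<beta> \<le> \<kappa> * norm (x - y) powr \<alpha>"
      if "\<bar>s\<bar> \<le> \<kappa> * norm (x - y)" "\<alpha> \<le> \<beta>" "\<beta> \<le> 1" for s \<beta>
    proof -
      have "\<bar>s\<bar> powr \<beta> \<le> (\<kappa> * norm (x - y)) powr \<beta>"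
        using that assms(3) by (intro powr_mono2) auto
      also have "\<dots> = \<kappa> powr \<beta> * norm (x - y) powr \<beta>" using \<kappa>(1) by (simp add: powr_mult)
      also have "\<dots> \<le> \<kappa> powr 1 * norm (x - y) powr \<alpha>"
        using \<kappa>(1) that True by (intro mult_mono powr_mono powr_mono') auto
      finally show ?thesis using \<kappa>(1) by simp
    qed
    have x: "x = (y + s *\<^sub>R vp) + t *\<^sub>R vm" using st(1) by (simp add: algebra_simps)
    have "\<bar>W x - W y\<bar> \<le> \<bar>W ((y + s *\<^sub>R vp) + t *\<^sub>R vm) - W (y + s *\<^sub>R vp)\<bar> + \<bar>W (y + s *\<^sub>R vp) - W y\<bar>"
      unfolding x by linarith
    also have "\<dots> \<le> D * \<bar>t\<bar> powr \<alpha>m + D * \<bar>s\<bar> powr \<alpha>p" by (intro add_mono D)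
    also have "\<dots> \<le> D * (\<kappa> * norm (x - y) powr \<alpha>) + D * (\<kappa> * norm (x - y) powr \<alpha>)"
      using D(1) st assms by (intro add_mono mult_left_mono pow) auto
    also have "\<dots> = (2 * D * \<kappa>) * norm (x - y) powr \<alpha>" by simp
    also have "\<dots> \<le> (2 * M + 2 * D * \<kappa>) * norm (x - y) powr \<alpha>" using M by (intro mult_right_mono) auto
    finally show ?thesis .
  next
    case False
    have "\<bar>W x - W y\<bar> \<le> 2 * M" using bound[of x] bound[of y] by linarith
    also have "\<dots> \<le> 2 * M * norm (x - y) powr \<alpha>"
      using False M assms(3) by (intro mult_le_cancel_left1[THEN iffD2]) (auto simp: ge_one_powr_ge_zero)
    also have "\<dots> \<le> (2 * M + 2 * D * \<kappa>) * norm (x - y) powr \<alpha>"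
      using D(1) \<kappa>(1) by (intro mult_right_mono) auto
    finally show ?thesis .
  qed
  then show ?thesis using M D(1) \<kappa>(1) by (intro exI[of _ "2 * M + 2 * D * \<kappa>"]) auto
qed

subsection \<open>Attraction to the invariant graph\<close>

lemma torus_cell_representative: "\<exists>\<psi>'\<in>torus_cell. \<forall>f. torus_fun f \<longrightarrow> f \<psi>' = f \<psi>"
proof -
  define m where "m i = - \<lfloor>\<psi> $ i / (2 * pi)\<rfloor>" for i
  define \<psi>' where "\<psi>' = \<psi> + axis 1 (2 * pi * of_int (m 1)) + axis 2 (2 * pi * of_int (m 2))"
  have "\<psi>' $ i = \<psi> $ i - of_int \<lfloor>\<psi> $ i / (2 * pi)\<rfloor> * (2 * pi)" for i
    using exhaust_2[of i] by (auto simp: \<psi>'_def m_def axis_def)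
  note coord = this
  have floor: "of_int \<lfloor>\<psi> $ i / (2 * pi)\<rfloor> * (2 * pi) \<le> \<psi> $ i"
    "\<psi> $ i < (of_int \<lfloor>\<psi> $ i / (2 * pi)\<rfloor> + 1) * (2 * pi)" for i
    by (intro floor_divide_lower floor_divide_upper; simp)+
  have "0 \<le> \<psi>' $ i \<and> \<psi>' $ i \<le> 2 * pi" for i
    unfolding coord using floor(1)[of i] floor(2)[of i] by (simp add: distrib_right)
  then have "\<psi>' \<in> torus_cell" by (simp add: mem_box_cart)
  then show ?thesis
    by (intro bexI[of _ \<psi>']) (auto simp: \<psi>'_def torus_fun_shift)
qed

text \<open>By periodicity the minimum over the compact product with one cell is global. The empty
  interval is included because a barrier used below may lie outside \<open>[a, b]\<close>.\<close>

lemma torus_fun_uniformly_positive: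
  fixes h :: "real \<times> (real^2) \<Rightarrow> real"
  assumes "continuous_on ({l..u} \<times> UNIV) h" "\<And>\<phi>. torus_fun (\<lambda>\<psi>. h (\<phi>, \<psi>))"
    and pos: "\<And>\<phi> \<psi>. \<phi> \<in> {l..u} \<Longrightarrow> 0 < h (\<phi>, \<psi>)"
  shows "\<exists>c>0. \<forall>\<phi>\<in>{l..u}. \<forall>\<psi>. c \<le> h (\<phi>, \<psi>)"
proof (cases "{l..u} = {}")
  case False
  have "continuous_on ({l..u} \<times> torus_cell) h"
    using assms(1) by (rule continuous_on_subset) auto
  moreover have "{l..u} \<times> torus_cell \<noteq> {}"
    using False torus_cell_representative[of 0] by auto
  ultimately have "\<exists>p\<in>{l..u} \<times> torus_cell. \<forall>q\<in>{l..u} \<times> torus_cell. h p \<le> h q"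
    by (intro continuous_attains_inf compact_Times compact_Icc compact_cbox)
  then obtain p where p: "p \<in> {l..u} \<times> torus_cell" "\<forall>q\<in>{l..u} \<times> torus_cell. h p \<le> h q"
    by (elim bexE)
  have "h p \<le> h (\<phi>, \<psi>)" if \<phi>: "\<phi> \<in> {l..u}" for \<phi> \<psi>
  proof -
    obtain \<psi>' where "\<psi>' \<in> torus_cell" "h (\<phi>, \<psi>') = h (\<phi>, \<psi>)"
      using torus_cell_representative[of \<psi>] assms(2)[of \<phi>] by blast
    then show ?thesis using bspec[OF p(2), of "(\<phi>, \<psi>')"] \<phi> by (simp del: mem_box)
  qed
  moreover have "0 < h p" using p(1) pos by (cases p) auto
  ultimately show ?thesis by blast
qed (auto intro: exI[of _ 1])

text \<open>The quantity \<open>max s (b - real n * c)\<close> bounds the sequence at every time.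
  The lemma is applied to the fibre coordinate and, for the lower barrier, to its negative.\<close>

lemma eventually_below_barrier:
  fixes x :: "nat \<Rightarrow> real"
  assumes "0 < c" "\<And>n. s < x n \<Longrightarrow> x (Suc n) \<le> x n - c" "\<And>n. x n \<le> s \<Longrightarrow> x (Suc n) \<le> s"
    and "x 0 \<le> b" "b - s \<le> real n * c"
  shows "x n \<le> s"
proof -
  have "x n \<le> max s (b - real n * c)" for n
  proof (induction n)
    case (Suc n)
    then show ?case
      using assms(2)[of n] assms(3)[of n] by (cases "x n \<le> s") (auto simp: algebra_simps le_max_iff_disj)
  qed (use assms in auto)
  then show ?thesis using assms(5) by (metis add.commute diff_le_eq max.absorb1)
qed

section \<open>Fibre dynamics of the skew product\<close>

lemma skew_map_Pair: "skew_map F A (\<phi>, \<psi>) = (\<phi> + F (\<phi>, \<psi>), A *v \<psi>)"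
  by (simp add: skew_map_def)

lemma snd_skew_map_power: "snd ((skew_map F A ^^ n) p) = ((*v) A ^^ n) (snd p)"
  by (induction n) (simp_all add: skew_map_def split_beta)

lemma zero_curve:
  assumes "hypothesis2 F a b"
  shows "zero_curve F a b \<psi> \<in> {a<..<b}" "F (zero_curve F a b \<psi>, \<psi>) = 0"
    and "\<phi> \<in> {a<..<b} \<Longrightarrow> F (\<phi>, \<psi>) = 0 \<Longrightarrow> \<phi> = zero_curve F a b \<psi>"
proof -
  have ex: "\<exists>!\<phi>. \<phi> \<in> {a<..<b} \<and> F (\<phi>, \<psi>) = 0" using assms by (simp add: hypothesis2_def)
  show "zero_curve F a b \<psi> \<in> {a<..<b}" "F (zero_curve F a b \<psi>, \<psi>) = 0"
    using theI'[OF ex] by (auto simp: zero_curve_def)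
  then show "\<phi> \<in> {a<..<b} \<Longrightarrow> F (\<phi>, \<psi>) = 0 \<Longrightarrow> \<phi> = zero_curve F a b \<psi>"
    using ex by blast
qed

locale skew_system =
  fixes F :: "real \<times> (real^2) \<Rightarrow> real" and A :: "real^2^2" and a b \<alpha>0 :: real
  assumes \<alpha>0: "0 < \<alpha>0" and F: "F \<in> B_space_torus \<alpha>0 6"
    and hyp1: "hypothesis1 F a b" and hyp2: "hypothesis2 F a b" and hyp3: "hypothesis3 F a b"
begin

abbreviation "zc \<equiv> zero_curve F a b"
abbreviation "dF \<equiv> dphi UNIV F"
definition "sm = (INF \<psi>. zc \<psi>)"
definition "SM = (SUP \<psi>. zc \<psi>)"
definition "NF = enn2real (B_norm UNIV \<alpha>0 6 F)"

lemma F_space: "F \<in> B_space UNIV \<alpha>0 6" using F by (simp add: B_space_torus_def)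

lemma ab: "a < b" using hyp1 by (simp add: hypothesis1_def)

lemma torus_fun_F: "torus_fun (\<lambda>\<psi>. F (\<phi>, \<psi>))"
  using F_space by (simp add: B_space_def)

lemma continuous_on_F: "continuous_on S F"
  using B_space_continuous_on[OF F_space \<alpha>0, of 0] by (auto intro: continuous_on_subset)

lemma F_deriv: "((\<lambda>t. F (t, \<psi>)) has_real_derivative dF (\<phi>, \<psi>)) (at \<phi> within S)"
  using B_space_has_derivative[OF F_space, of 0 \<phi> \<psi>] by (auto intro: DERIV_subset)

lemma step_deriv: "((\<lambda>t. t + F (t, \<psi>)) has_real_derivative 1 + dF (\<phi>, \<psi>)) (at \<phi> within S)"
  by (auto intro!: derivative_eq_intros F_deriv)

lemma dF_lipschitz: "\<bar>dF (\<phi>, \<psi>) - dF (\<phi>', \<psi>)\<bar> \<le> NF * \<bar>\<phi> - \<phi>'\<bar>"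
  using B_space_lipschitz[OF F_space \<alpha>0, of 1 \<phi> \<phi>' \<psi>] by (simp add: NF_def)

lemma dF_le_NF: "\<bar>dF p\<bar> \<le> NF"
  using B_norm_bounds(1)[OF F_space \<alpha>0, of _ 1] by (cases p) (simp add: NF_def)

lemma dF_gt: "\<phi> \<in> {a..b} \<Longrightarrow> 0 < 1 + dF (\<phi>, \<psi>)"
  using hyp1 by (simp add: hypothesis1_def)

lemma F_ends: "0 < F (a, \<psi>)" "F (b, \<psi>) < 0"
  using hyp1 by (auto simp: hypothesis1_def)

lemma step_mono:
  assumes "\<phi> \<in> {a..b}" "\<phi>' \<in> {a..b}" "\<phi> \<le> \<phi>'"
  shows "\<phi> + F (\<phi>, \<psi>) \<le> \<phi>' + F (\<phi>', \<psi>)"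
proof (rule DERIV_nonneg_imp_nondecreasing[OF assms(3)])
  fix x assume "\<phi> \<le> x" "x \<le> \<phi>'"
  then have "0 < 1 + dF (x, \<psi>)" using assms by (intro dF_gt) auto
  then show "\<exists>y. ((\<lambda>t. t + F (t, \<psi>)) has_real_derivative y) (at x) \<and> 0 \<le> y"
    using step_deriv[of \<psi> x UNIV] by (intro exI[of _ "1 + dF (x, \<psi>)"]) simp
qed

text \<open>The fibre maps are monotone, move \<open>a\<close> up and move \<open>b\<close>
  down.\<close>

lemma step_in: "\<phi> \<in> {a..b} \<Longrightarrow> \<phi> + F (\<phi>, \<psi>) \<in> {a..b}"
  using step_mono[of a \<phi> \<psi>] step_mono[of \<phi> b \<psi>] F_ends[of \<psi>] ab by auto

lemma skew_map_in: "p \<in> {a..b} \<times> UNIV \<Longrightarrow> (skew_map F A ^^ n) p \<in> {a..b} \<times> UNIV"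
proof (induction n)
  case (Suc n)
  then show ?case
    by (cases "(skew_map F A ^^ n) p") (use step_in in \<open>auto simp: skew_map_Pair\<close>)
qed simp

lemma continuous_on_skew_map_power: "continuous_on S (skew_map F A ^^ n)"
proof (induction n)
  case (Suc n)
  have "continuous_on UNIV (skew_map F A)"
    unfolding skew_map_def split_beta
    by (intro continuous_intros linear_continuous_on_compose[OF _ matrix_vector_mul_linear]) 
       (auto intro!: continuous_on_F)
  then have "continuous_on ((skew_map F A ^^ n) ` S) (skew_map F A)" by (rule continuous_on_subset) simp
  with Suc have "continuous_on S (skew_map F A \<circ> (skew_map F A ^^ n))" by (rule continuous_on_compose)
  then show ?case by simp
qed (simp add: id_def)

text \<open>A nonnegative value here and the negative value at \<open>b\<close> would, by the
  intermediate value theorem, produce a second zero on the fibre, to the right of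
  \<open>zc \<psi>\<close>.\<close>

lemma F_neg:
  assumes "zc \<psi> < \<phi>" "\<phi> \<le> b"
  shows "F (\<phi>, \<psi>) < 0"
proof (rule ccontr)
  assume "\<not> F (\<phi>, \<psi>) < 0"
  then have "\<exists>x\<ge>\<phi>. x \<le> b \<and> F (x, \<psi>) = 0"
    using F_ends(2)[of \<psi>] assms(2)
    by (intro IVT2') (auto intro!: continuous_on_compose2[OF continuous_on_F] continuous_intros)
  then obtain x where x: "\<phi> \<le> x" "x \<le> b" "F (x, \<psi>) = 0" by blast
  have "x \<noteq> b" using x(3) F_ends(2)[of \<psi>] by auto
  moreover have "a < zc \<psi>" using zero_curve(1)[OF hyp2, of \<psi>] by simp
  ultimately have "x = zc \<psi>" using x assms by (intro zero_curve(3)[OF hyp2]) auto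
  then show False using x assms by simp
qed

lemma F_pos:
  assumes "\<phi> < zc \<psi>" "a \<le> \<phi>"
  shows "0 < F (\<phi>, \<psi>)"
proof (rule ccontr)
  assume "\<not> 0 < F (\<phi>, \<psi>)"
  then have "\<exists>x\<ge>a. x \<le> \<phi> \<and> F (x, \<psi>) = 0"
    using F_ends(1)[of \<psi>] assms(2)
    by (intro IVT2') (auto intro!: continuous_on_compose2[OF continuous_on_F] continuous_intros)
  then obtain x where x: "a \<le> x" "x \<le> \<phi>" "F (x, \<psi>) = 0" by blast
  have "x \<noteq> a" using x(3) F_ends(1)[of \<psi>] by auto
  moreover have "zc \<psi> < b" using zero_curve(1)[OF hyp2, of \<psi>] by simp
  ultimately have "x = zc \<psi>" using x assms by (intro zero_curve(3)[OF hyp2]) auto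
  then show False using x assms by simp
qed

lemma zc_bounds: "a \<le> sm" "sm \<le> zc \<psi>" "zc \<psi> \<le> SM" "SM \<le> b"
proof -
  have zc: "a < zc \<psi>" "zc \<psi> < b" for \<psi> using zero_curve(1)[OF hyp2, of \<psi>] by auto
  have bdd: "bdd_below (range zc)" "bdd_above (range zc)"
    using zc by (auto intro!: bdd_belowI[of _ a] bdd_aboveI[of _ b] simp: less_imp_le)
  show "a \<le> sm" unfolding sm_def using zc by (intro cINF_greatest) (auto simp: less_imp_le)
  show "SM \<le> b" unfolding SM_def using zc by (intro cSUP_least) (auto simp: less_imp_le)
  show "sm \<le> zc \<psi>" unfolding sm_def using bdd by (intro cINF_lower) auto
  show "zc \<psi> \<le> SM" unfolding SM_def using bdd by (intro cSUP_upper) auto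
qed

lemma dF_le_Gamma:
  assumes "\<phi> \<in> {sm..SM}"
  shows "dF (\<phi>, \<psi>) \<le> - Gamma_const F a b"
proof -
  have "bdd_above (dF ` Lambda_set F a b)"
    using dF_le_NF by (auto intro!: bdd_aboveI[of _ NF] simp: abs_le_iff)
  moreover have "(\<phi>, \<psi>) \<in> Lambda_set F a b"
    using assms by (simp add: Lambda_set_def sm_def SM_def)
  ultimately show ?thesis unfolding Gamma_const_def by (simp add: cSUP_upper)
qed

text \<open>The inclusion must persist at all later times: a monotone fibre map cannot carry a point
  across a barrier that it moves inwards. The upper and the lower barrier are treated separately,
  each with its own minimal drift.\<close>

lemma eventually_near_zero_curve:
  assumes "0 < \<delta>"
  shows "\<exists>n0. \<forall>n\<ge>n0. \<forall>p\<in>{a..b} \<times> UNIV. fst ((skew_map F A ^^ n) p) \<in> {sm - \<delta>..SM + \<delta>}"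
proof -
  have neg: "F (\<phi>, \<psi>) < 0" if "SM + \<delta> \<le> \<phi>" "\<phi> \<le> b" for \<phi> \<psi>
    using F_neg[of \<psi> \<phi>] zc_bounds(3)[of \<psi>] that assms by simp
  have pos: "0 < F (\<phi>, \<psi>)" if "\<phi> \<le> sm - \<delta>" "a \<le> \<phi>" for \<phi> \<psi>
    using F_pos[of \<phi> \<psi>] zc_bounds(2)[of \<psi>] that assms by simp
  have "\<exists>c>0. \<forall>\<phi>\<in>{SM + \<delta>..b}. \<forall>\<psi>. c \<le> - F (\<phi>, \<psi>)"
    using torus_fun_F neg
    by (intro torus_fun_uniformly_positive[where h="\<lambda>p. - F p"] continuous_on_minus continuous_on_F) (auto simp: torus_fun_def)
  then obtain c where c: "0 < c" "\<And>\<phi> \<psi>. \<phi> \<in> {SM + \<delta>..b} \<Longrightarrow> c \<le> - F (\<phi>, \<psi>)" by blast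
  have "\<exists>d>0. \<forall>\<phi>\<in>{a..sm - \<delta>}. \<forall>\<psi>. d \<le> F (\<phi>, \<psi>)"
    using torus_fun_F pos by (intro torus_fun_uniformly_positive continuous_on_F) auto
  then obtain d where d: "0 < d" "\<And>\<phi> \<psi>. \<phi> \<in> {a..sm - \<delta>} \<Longrightarrow> d \<le> F (\<phi>, \<psi>)" by blast
  obtain n1 where n1: "b - (SM + \<delta>) \<le> real n1 * c" using reals_Archimedean3[OF c(1)] less_imp_le by blast
  obtain n2 where n2: "- a - (- (sm - \<delta>)) \<le> real n2 * d" using reals_Archimedean3[OF d(1)] less_imp_le by blast
  have "fst ((skew_map F A ^^ n) p) \<in> {sm - \<delta>..SM + \<delta>}"
    if n: "max n1 n2 \<le> n" and p: "p \<in> {a..b} \<times> UNIV" for n p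
  proof -
    define x where "x n = fst ((skew_map F A ^^ n) p)" for n
    define y where "y n = snd ((skew_map F A ^^ n) p)" for n
    have x_in: "a \<le> x n" "x n \<le> b" for n
      using skew_map_in[OF p, of n] by (auto simp: x_def mem_Times_iff)
    have step: "x (Suc n) = x n + F (x n, y n)" for n
      by (simp add: x_def y_def skew_map_def split_beta)
    have "real n1 * c \<le> real n * c" "real n2 * d \<le> real n * d"
      using n c d by (auto intro!: mult_right_mono)
    with n1 n2 have nn: "b - (SM + \<delta>) \<le> real n * c" "- a - (- (sm - \<delta>)) \<le> real n * d" by linarith+
    have "x n \<le> SM + \<delta>"
    proof (rule eventually_below_barrier[OF c(1) _ _ x_in(2) nn(1)])
      fix n
      show "x (Suc n) \<le> x n - c" if "SM + \<delta> < x n"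
        using c(2)[of "x n" "y n"] that x_in[of n] by (simp add: step)
      show "x (Suc n) \<le> SM + \<delta>" if "x n \<le> SM + \<delta>"
      \<comment> \<open>A barrier beyond \<open>b\<close> is respected because \<open>[a, b]\<close>
        is invariant; monotonicity is available only for barriers inside.\<close>
      proof (cases "SM + \<delta> \<le> b")
        case True
        have "a \<le> SM + \<delta>" using zc_bounds(1,4) zc_bounds(2,3)[of 0] assms by linarith
        then show ?thesis
          using step_mono[of "x n" "SM + \<delta>" "y n"] neg[of "SM + \<delta>" "y n"] True that x_in[of n] by (simp add: step)
      qed (use x_in[of "Suc n"] in simp)
    qed
    moreover have "- x n \<le> - (sm - \<delta>)"
    proof (rule eventually_below_barrier[OF d(1) _ _ _ nn(2), of "\<lambda>n. - x n"])
      fix n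
      show "- x (Suc n) \<le> - x n - d" if "- (sm - \<delta>) < - x n"
        using d(2)[of "x n" "y n"] that x_in[of n] by (simp add: step)
      show "- x (Suc n) \<le> - (sm - \<delta>)" if "- x n \<le> - (sm - \<delta>)"
      proof (cases "a \<le> sm - \<delta>")
        case True
        have "sm - \<delta> \<le> b" using zc_bounds(1,4) zc_bounds(2,3)[of 0] assms by linarith
        then show ?thesis
          using step_mono[of "sm - \<delta>" "x n" "y n"] pos[of "sm - \<delta>" "y n"] True that x_in[of n] by (simp add: step)
      qed (use x_in[of "Suc n"] in simp)
    qed (use x_in in auto)
    ultimately show ?thesis by (simp add: x_def)
  qed
  then show ?thesis by blast
qed

lemma invariant_graph_in:
  assumes "invariant_graph F A a b W"
  shows "W \<psi> \<in> {sm..SM}" "W \<psi> \<in> {a..b}"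
proof -
  show "W \<psi> \<in> {sm..SM}"
    using assms by (auto simp: invariant_graph_def Lambda_set_def sm_def SM_def)
  then show "W \<psi> \<in> {a..b}" using zc_bounds(1,4) by auto
qed

text \<open>An orbit and the graph are compared over the same base orbit, so both heights evolve
  under the same fibre map, which contracts by \<open>r\<close> as soon as both lie in
  \<open>?I\<close>.\<close>

lemma invariant_graph_attraction:
  assumes W: "invariant_graph F A a b W" and r: "1 - Gamma_const F a b < r" "r < 1"
  shows "\<exists>C\<ge>0. \<forall>n. \<forall>\<phi>\<in>{a..b}. \<forall>\<psi>. \<bar>fst ((skew_map F A ^^ n) (\<phi>, \<psi>)) - W (((*v) A ^^ n) \<psi>)\<bar> \<le> C * r ^ n"
proof -
  \<comment> \<open>At a point of the graph the fibre derivative is positive and at most one minus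
    the constant of hypothesis 3; so \<open>r\<close> is positive.\<close>
  have "0 < 1 + dF (W 0, 0)" by (intro dF_gt invariant_graph_in(2)[OF W])
  also have "\<dots> \<le> 1 - Gamma_const F a b" using dF_le_Gamma[OF invariant_graph_in(1)[OF W], of 0] by simp
  finally have r0: "0 < r" using r by simp
  have NF: "0 \<le> NF" by (simp add: NF_def)
  \<comment> \<open>\<open>NF\<close> is a Lipschitz constant of \<open>dF\<close>, so over this
    width the derivative changes by at most the slack left by \<open>r\<close>; the summand 1 avoids
    division by zero.\<close>
  define \<delta> where "\<delta> = (r - (1 - Gamma_const F a b)) / (NF + 1)"
  have \<delta>: "0 < \<delta>" using r NF by (simp add: \<delta>_def)
  have "NF * \<delta> \<le> (NF + 1) * \<delta>" using \<delta> by simp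
  also have "\<dots> = r - (1 - Gamma_const F a b)" using NF by (simp add: \<delta>_def)
  finally have NF\<delta>: "NF * \<delta> \<le> r - (1 - Gamma_const F a b)" .
  let ?I = "{max a (sm - \<delta>)..min b (SM + \<delta>)}"
  have contr: "\<bar>(\<phi> + F (\<phi>, \<psi>)) - (\<phi>' + F (\<phi>', \<psi>))\<bar> \<le> r * \<bar>\<phi> - \<phi>'\<bar>"
    if "\<phi> \<in> ?I" "\<phi>' \<in> ?I" for \<phi> \<phi>' \<psi>
  proof -
    have "norm (1 + dF (z, \<psi>)) \<le> r" if z: "z \<in> ?I" for z
    proof -
      \<comment> \<open>The point of \<open>[sm, SM]\<close> nearest to \<open>z\<close>, where
        \<open>dF_le_Gamma\<close> applies.\<close>
      define z' where "z' = max sm (min SM z)"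
      have z': "z' \<in> {sm..SM}" "\<bar>z - z'\<bar> \<le> \<delta>"
        using z zc_bounds(2,3)[of 0] \<delta> by (auto simp: z'_def)
      have "dF (z, \<psi>) \<le> dF (z', \<psi>) + NF * \<bar>z - z'\<bar>"
        using dF_lipschitz[of z \<psi> z'] by linarith
      also have "\<dots> \<le> - Gamma_const F a b + NF * \<delta>"
        using z' NF by (intro add_mono dF_le_Gamma mult_left_mono) auto
      finally have "1 + dF (z, \<psi>) \<le> r" using NF\<delta> by linarith
      moreover have "0 < 1 + dF (z, \<psi>)" using z by (intro dF_gt) auto
      ultimately show ?thesis by simp
    qed
    then have "norm ((\<phi> + F (\<phi>, \<psi>)) - (\<phi>' + F (\<phi>', \<psi>))) \<le> r * norm (\<phi> - \<phi>')"
      using that by (intro field_differentiable_bound[where S="?I", OF _ step_deriv]) auto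
    then show ?thesis by simp
  qed
  obtain n0 where n0: "\<And>n p. n0 \<le> n \<Longrightarrow> p \<in> {a..b} \<times> UNIV \<Longrightarrow> fst ((skew_map F A ^^ n) p) \<in> {sm - \<delta>..SM + \<delta>}"
    using eventually_near_zero_curve[OF \<delta>] by blast
  \<comment> \<open>Up to time \<open>n0\<close> the distance is at most \<open>b - a\<close>, and
    \<open>r ^ n0\<close> is the smallest power of \<open>r\<close> occurring up to then.\<close>
  define C where "C = (b - a) / r ^ n0"
  have C: "0 \<le> C" using ab r0 by (simp add: C_def)
  have "\<bar>fst ((skew_map F A ^^ n) (\<phi>, \<psi>)) - W (((*v) A ^^ n) \<psi>)\<bar> \<le> C * r ^ n"
    if \<phi>: "\<phi> \<in> {a..b}" for n \<phi> \<psi>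
  proof -
    define x where "x n = fst ((skew_map F A ^^ n) (\<phi>, \<psi>))" for n
    define y where "y n = ((*v) A ^^ n) \<psi>" for n
    have x_in: "x n \<in> {a..b}" for n
      using skew_map_in[of "(\<phi>, \<psi>)" n] \<phi> by (auto simp: x_def mem_Times_iff)
    have step: "x (Suc n) = x n + F (x n, y n)" for n
      using snd_skew_map_power[of n F A "(\<phi>, \<psi>)"] by (simp add: x_def y_def skew_map_def split_beta)
    have stepW: "W (y (Suc n)) = W (y n) + F (W (y n), y n)" for n
      using W by (simp add: invariant_graph_def skew_map_Pair y_def)
    have "\<bar>x n - W (y n)\<bar> \<le> C * r ^ n"
    proof (cases "n0 \<le> n")
      case False
      have "\<bar>x n - W (y n)\<bar> \<le> b - a" using x_in[of n] invariant_graph_in(2)[OF W, of "y n"] by auto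
      also have "\<dots> = C * r ^ n0" using r0 by (simp add: C_def)
      also have "\<dots> \<le> C * r ^ n" using C r0 r(2) False by (intro mult_left_mono power_decreasing) auto
      finally show ?thesis .
    next
      case True
      then show ?thesis
      proof (induction n rule: dec_induct)
        case base
        have "\<bar>x n0 - W (y n0)\<bar> \<le> b - a" using x_in[of n0] invariant_graph_in(2)[OF W, of "y n0"] by auto
        also have "\<dots> = C * r ^ n0" using r0 by (simp add: C_def)
        finally show ?case .
      next
        case (step m)
        have "x m \<in> ?I" using n0[OF step(1), of "(\<phi>, \<psi>)"] \<phi> x_in[of m] by (auto simp: x_def)
        moreover have "W (y m) \<in> ?I"
          using invariant_graph_in[OF W, of "y m"] \<delta> by auto
        ultimately have "\<bar>x (Suc m) - W (y (Suc m))\<bar> \<le> r * \<bar>x m - W (y m)\<bar>"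
          unfolding \<open>\<And>n. x (Suc n) = x n + F (x n, y n)\<close> stepW by (rule contr)
        also have "\<dots> \<le> r * (C * r ^ m)" using step r0 by (intro mult_left_mono) auto
        finally show ?case by (simp add: mult_ac)
      qed
    qed
    then show ?thesis by (simp add: x_def y_def)
  qed
  then show ?thesis using C by blast
qed

end

subsection \<open>The skew product\<close>

text \<open>The integral of a non-integrable function is 0 by convention, which settles that case; a
  bound on the fibre integrals alone can thus be integrated over \<open>\<phi>\<close>.\<close>

lemma norm_integral_le_content:
  fixes f :: "'a::euclidean_space \<Rightarrow> 'b::euclidean_space"
  assumes "0 \<le> B" "\<And>x. x \<in> cbox u v \<Longrightarrow> norm (f x) \<le> B"
  shows "norm (integral (cbox u v) f) \<le> B * measure lborel (cbox u v)"
proof (cases "f integrable_on cbox u v")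
  case True
  then show ?thesis using assms by (intro has_integral_bound[OF _ integrable_integral]) auto
qed (use assms in \<open>simp add: not_integrable_integral\<close>)

lemma torus_mean_eq_integral:
  assumes "continuous_on UNIV h"
  shows "torus_mean h = integral torus_cell h / (2 * pi)\<^sup>2"
  unfolding torus_mean_def
  by (subst compact_set_integral_eq_integral) (auto intro: continuous_on_subset[OF assms])

lemma torus_mean_diff:
  assumes "continuous_on UNIV f" "continuous_on UNIV g"
  shows "torus_mean (\<lambda>x. f x - g x) = torus_mean f - torus_mean g"
proof -
  have "f integrable_on torus_cell" "g integrable_on torus_cell"
    using assms by (auto intro!: integrable_continuous intro: continuous_on_subset)
  then show ?thesis
    using assms by (simp add: torus_mean_eq_integral continuous_on_diff Henstock_Kurzweil_Integration.integral_diff diff_divide_distrib)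
qed

lemma torus_mean_mult_right: "torus_mean (\<lambda>x. f x * c) = torus_mean f * c"
  by (simp add: torus_mean_def)

lemma product_cell: "{a..b} \<times> torus_cell = cbox (a, 0) (b, \<chi> i. 2 * pi)" for a b :: real
  by (simp add: cbox_Pair_eq)

lemma continuous_on_product_cell:
  fixes a b :: real
  assumes "continuous_on ({a..b} \<times> UNIV) f"
  shows "continuous_on (cbox (a, 0) (b, \<chi> i. 2 * pi)) f"
  using assms by (rule continuous_on_subset) (auto simp: product_cell[symmetric])

lemma nu_0_eq_integral:
  assumes "continuous_on ({a..b} \<times> UNIV) f"
  shows "nu_0 a b f = integral (cbox (a, 0) (b, \<chi> i. 2 * pi)) f / ((2 * pi)\<^sup>2 * (b - a))"
  unfolding nu_0_def product_cell
  by (subst compact_set_integral_eq_integral)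
     (rule compact_cbox continuous_on_product_cell[OF assms] refl)+

lemma nu_0_diff:
  assumes "continuous_on ({a..b} \<times> UNIV) f" "continuous_on ({a..b} \<times> UNIV) g"
  shows "nu_0 a b (\<lambda>p. f p - g p) = nu_0 a b f - nu_0 a b g"
proof -
  have "f integrable_on cbox (a, 0) (b, \<chi> i. 2 * pi)" "g integrable_on cbox (a, 0) (b, \<chi> i. 2 * pi)"
    by (intro integrable_continuous continuous_on_product_cell assms)+
  then show ?thesis
    using assms by (simp add: nu_0_eq_integral continuous_on_diff Henstock_Kurzweil_Integration.integral_diff diff_divide_distrib)
qed

lemma nu_0_mult_right: "nu_0 a b (\<lambda>p. f p * c) = nu_0 a b f * c"
  by (simp add: nu_0_def)

text \<open>By Fubini, bounds uniform in \<open>\<phi>\<close> pass to the whole space; this is how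
  torus estimates on single fibres become estimates for \<open>nu_0\<close>.\<close>

lemma nu_0_fibre_bound:
  assumes "a < b" "continuous_on ({a..b} \<times> UNIV) h"
    and "\<And>\<phi>. \<phi> \<in> {a..b} \<Longrightarrow> \<bar>torus_mean (\<lambda>\<psi>. h (\<phi>, \<psi>))\<bar> \<le> B"
  shows "\<bar>nu_0 a b h\<bar> \<le> B"
proof -
  have "0 \<le> B" using order_trans[OF abs_ge_zero assms(3)[of a]] assms(1) by simp
  have "\<bar>integral torus_cell (\<lambda>\<psi>. h (\<phi>, \<psi>))\<bar> \<le> (2 * pi)\<^sup>2 * B" if "\<phi> \<in> {a..b}" for \<phi>
  proof -
    have "continuous_on UNIV (\<lambda>\<psi>. h (\<phi>, \<psi>))"
      using that by (intro continuous_on_compose2[OF assms(2)] continuous_intros) auto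
    then have "\<bar>integral torus_cell (\<lambda>\<psi>. h (\<phi>, \<psi>))\<bar> / (2 * pi)\<^sup>2 \<le> B"
      using assms(3)[OF that] by (simp add: torus_mean_eq_integral abs_divide)
    then show ?thesis by (subst (asm) divide_le_eq) (simp add: mult.commute)
  qed
  then have "norm (integral (cbox a b) (\<lambda>\<phi>. integral torus_cell (\<lambda>\<psi>. h (\<phi>, \<psi>)))) \<le> ((2 * pi)\<^sup>2 * B) * measure lborel (cbox a b)"
    using \<open>0 \<le> B\<close> by (intro norm_integral_le_content) auto
  moreover have "integral (cbox (a, 0) (b, \<chi> i. 2 * pi)) h = integral (cbox a b) (\<lambda>\<phi>. integral torus_cell (\<lambda>\<psi>. h (\<phi>, \<psi>)))"
    by (intro integral_prod_continuous continuous_on_product_cell assms)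
  ultimately have "\<bar>integral (cbox (a, 0) (b, \<chi> i. 2 * pi)) h\<bar> \<le> B * ((2 * pi)\<^sup>2 * (b - a))"
    using assms(1) by (simp add: mult_ac)
  moreover have "0 < (2 * pi)\<^sup>2 * (b - a)" using assms(1) by simp
  ultimately show ?thesis
    unfolding nu_0_eq_integral[OF assms(2)] abs_divide by (simp only: abs_of_pos pos_divide_le_eq)
qed

lemma abs_torus_mean_le:
  assumes "continuous_on UNIV h" "\<And>x. \<bar>h x\<bar> \<le> B"
  shows "\<bar>torus_mean h\<bar> \<le> B"
proof -
  have "cmod (cmean (\<lambda>x. of_real (h x))) \<le> B"
    using assms by (intro cmean_bound continuous_on_of_real) auto
  then show ?thesis by (simp add: cmean_of_real[OF assms(1)])
qed

text \<open>The base point is moved first at fixed height, then the height is moved, with the sup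
  norm of the \<open>\<phi>\<close>-derivative as Lipschitz constant. This transfers the regularity
  of the graph to the observable.\<close>

lemma observable_on_graph_holder:
  assumes W: "\<And>\<psi>. W \<psi> \<in> {a..b}" "\<And>x y. \<bar>W x - W y\<bar> \<le> D * norm (x - y) powr \<alpha>"
    and g: "g \<in> B_space {a..b} \<alpha> 1" "0 < \<alpha>"
  shows "\<bar>g (W x, x) - g (W y, y)\<bar> \<le> enn2real (B_norm {a..b} \<alpha> 1 g) * (D + 1 / \<alpha>) * norm (x - y) powr \<alpha>"
proof -
  let ?N = "enn2real (B_norm {a..b} \<alpha> 1 g)"
  have "\<bar>g (W x, x) - g (W y, y)\<bar> \<le> \<bar>g (W x, x) - g (W x, y)\<bar> + \<bar>g (W x, y) - g (W y, y)\<bar>" by linarith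
  also have "\<bar>g (W x, x) - g (W x, y)\<bar> \<le> ?N / \<alpha> * norm (x - y) powr \<alpha>"
    using B_norm_bounds(2)[OF g W(1), of 0 x x y] by simp
  also have "\<bar>g (W x, y) - g (W y, y)\<bar> \<le> ?N * \<bar>W x - W y\<bar>"
    using B_space_lipschitz[OF g, of 0 "W x" "W y" y] W(1) by simp
  also have "\<dots> \<le> ?N * (D * norm (x - y) powr \<alpha>)" by (intro mult_left_mono W) auto
  finally show ?thesis by (simp add: algebra_simps)
qed

theorem theorem3:
  fixes F H :: "real \<times> (real^2) \<Rightarrow> real" and W :: "real^2 \<Rightarrow> real"
    and A :: "real^2^2" and lp lm :: real and vp vm :: "real^2"
    and a b \<alpha>0 \<alpha>m \<alpha>p \<alpha>s ls :: real
  assumes "anosov_automorphism A lp lm vp vm"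
    and "0 < \<alpha>0" "\<alpha>0 \<le> 1" "F \<in> B_space_torus \<alpha>0 6"
    and "hypothesis1 F a b" "hypothesis2 F a b" "hypothesis3 F a b"
    and "0 < \<alpha>m" "\<alpha>m \<le> \<alpha>0" "0 < \<alpha>p" "\<alpha>p \<le> \<alpha>0"
    and "W \<in> B_star vm vp \<alpha>m \<alpha>p" "invariant_graph F A a b W"
    and "0 < \<alpha>s" "\<alpha>s \<le> min \<alpha>m \<alpha>p"
    and "H \<in> B_space {a..b} \<alpha>s 2" "linearizing_conjugation F A a b W H"
    and "ls > 0" "inverse ls > max (\<bar>lp\<bar> powr (- \<alpha>s)) (1 - Gamma_const F a b)"
  shows "\<exists>C1. \<forall>O1\<in>B_space {a..b} \<alpha>s 1. \<forall>O2\<in>B_space {a..b} \<alpha>s 1. \<forall>n::nat.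
           \<bar>nu_0 a b (\<lambda>p. O1 p * O2 ((skew_map F A ^^ n) p)) - nu_0 a b O1 * nu_W W O2\<bar>
             \<le> C1 * enn2real (holder_norm {a..b} \<alpha>s O1)
                  * enn2real (B_norm {a..b} \<alpha>s 1 O2) * inverse ls ^ n"
proof -
  interpret skew_system F A a b \<alpha>0
    using assms by unfold_locales
  note W = assms(12,13)
  have W_in: "W \<psi> \<in> {a..b}" for \<psi> using invariant_graph_in(2)[OF W(2)] .
  let ?m = "max (\<bar>lp\<bar> powr (- \<alpha>s)) (1 - Gamma_const F a b)"
  have "\<bar>lp\<bar> powr (- \<alpha>s) < \<bar>lp\<bar> powr 0"
    using assms(1,14) by (intro powr_less_mono) (auto simp: anosov_automorphism_def)
  then have "?m < 1" using assms(1) hyp3 by (auto simp: anosov_automorphism_def hypothesis3_def split: if_splits)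
  \<comment> \<open>The attraction estimate needs a rate below 1, whereas \<open>inverse ls\<close>
    may be large. The midpoint between \<open>?m\<close> and 1 still exceeds
    \<open>?m\<close>.\<close>
  define r where "r = min (inverse ls) ((?m + 1) / 2)"
  have r: "?m < r" "r < 1" "r \<le> inverse ls"
    using \<open>?m < 1\<close> assms(19) unfolding r_def by (auto simp: min_less_iff_disj)
  have "0 \<le> \<bar>lp\<bar> powr (- \<alpha>s)" by simp
  then have r0: "0 < r" using r(1) by linarith
  have "\<bar>lp\<bar> powr (- \<alpha>s) < r" "\<alpha>s \<le> 1" using r(1) assms by auto
  have "\<exists>D\<ge>0. \<forall>x y. \<bar>W x - W y\<bar> \<le> D * norm (x - y) powr \<alpha>s"
  proof (rule B_star_holder[OF assms(1) W(1) assms(14), of "max \<bar>a\<bar> \<bar>b\<bar>"])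
    show "\<bar>W \<psi>\<bar> \<le> max \<bar>a\<bar> \<bar>b\<bar>" for \<psi> using W_in[of \<psi>] by auto
  qed (use assms in auto)
  then obtain D where D: "0 \<le> D" "\<And>x y. \<bar>W x - W y\<bar> \<le> D * norm (x - y) powr \<alpha>s" by blast
  obtain C where C: "0 \<le> C" "\<And>n \<phi> \<psi>. \<phi> \<in> {a..b} \<Longrightarrow>
      \<bar>fst ((skew_map F A ^^ n) (\<phi>, \<psi>)) - W (((*v) A ^^ n) \<psi>)\<bar> \<le> C * r ^ n"
    using invariant_graph_attraction[OF W(2), of r] r by auto
  obtain K where K: "\<And>f g M L M' L' n. torus_fun f \<Longrightarrow> torus_fun g \<Longrightarrow>
    (\<And>x. \<bar>f x\<bar> \<le> M) \<Longrightarrow> (\<And>x y. \<bar>f x - f y\<bar> \<le> L * norm (x - y) powr \<alpha>s) \<Longrightarrow> 0 \<le> L \<Longrightarrow>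
    (\<And>x. \<bar>g x\<bar> \<le> M') \<Longrightarrow> (\<And>x y. \<bar>g x - g y\<bar> \<le> L' * norm (x - y) powr \<alpha>s) \<Longrightarrow> 0 \<le> L' \<Longrightarrow>
    \<bar>torus_mean (\<lambda>x. f x * g (((*v) A ^^ n) x)) - torus_mean f * torus_mean g\<bar>
      \<le> K * (M + L) * (M' + L') * r ^ n"
  proof (rule anosov_correlation_decay[OF assms(1,14) \<open>\<alpha>s \<le> 1\<close> \<open>\<bar>lp\<bar> powr (- \<alpha>s) < r\<close>], goal_cases)
    case (1 C)
    show ?case by (rule 1(1)[OF 1(2)])
  qed
  \<comment> \<open>\<open>C\<close> comes from replacing the orbit by the graph. The other factors
    convert norms: sup bound plus Hoelder constant is \<open>N1 * (1 + 1 / \<alpha>s)\<close> for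
    \<open>O1\<close> on a fibre and \<open>N2 * (1 + (D + 1 / \<alpha>s))\<close> for
    \<open>O2\<close> on the graph. The modulus is taken because \<open>K\<close> comes without a
    sign.\<close>
  define C1 where "C1 = C + \<bar>K\<bar> * (1 + 1 / \<alpha>s) * (1 + (D + 1 / \<alpha>s))"
  have C1: "0 \<le> C1" using C(1) D(1) assms(14) by (simp add: C1_def)
  show ?thesis
  proof (intro exI[of _ C1] ballI allI)
    fix O1 O2 :: "real \<times> (real^2) \<Rightarrow> real" and n :: nat
    assume O: "O1 \<in> B_space {a..b} \<alpha>s 1" "O2 \<in> B_space {a..b} \<alpha>s 1"
    let ?S = "skew_map F A ^^ n" and ?T = "(*v) A ^^ n"
    define N1 where "N1 = enn2real (holder_norm {a..b} \<alpha>s O1)"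
    define N2 where "N2 = enn2real (B_norm {a..b} \<alpha>s 1 O2)"
    have N: "0 \<le> N1" "0 \<le> N2" by (simp_all add: N1_def N2_def)
    define g where "g \<psi> = O2 (W \<psi>, \<psi>)" for \<psi>
    have "holder_norm {a..b} \<alpha>s O1 < \<infinity>"
      using O(1) holder_norm_le_B_norm[of 1 "{a..b}" \<alpha>s O1] by (auto simp: B_space_def)
    note O1_bounds = holder_norm_bounds[OF this assms(14), folded N1_def]
    have O2_bound: "\<bar>O2 p\<bar> \<le> N2" if "p \<in> {a..b} \<times> UNIV" for p
      using that B_norm_bounds(1)[OF O(2) assms(14), of _ 0] by (auto simp: N2_def)
    have cont1: "continuous_on ({a..b} \<times> UNIV) O1" and cont2: "continuous_on ({a..b} \<times> UNIV) O2"
      using B_space_continuous_on[OF O(1) assms(14), of 0] B_space_continuous_on[OF O(2) assms(14), of 0] by auto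
    have g_holder: "\<bar>g x - g y\<bar> \<le> N2 * (D + 1 / \<alpha>s) * norm (x - y) powr \<alpha>s" for x y
      using observable_on_graph_holder[OF W_in D(2) O(2) assms(14)] by (simp add: g_def N2_def)
    have g_cont: "continuous_on S g" for S
      using holder_continuous_on[OF g_holder assms(14)] .
    have g_torus: "torus_fun g"
    proof -
      have "torus_fun W" using W(1) by (simp add: B_star_def)
      moreover have "torus_fun (\<lambda>\<psi>. O2 (\<phi>, \<psi>))" if "\<phi> \<in> {a..b}" for \<phi>
        using O(2) that by (simp add: B_space_def)
      ultimately show ?thesis using W_in by (simp add: torus_fun_def g_def)
    qed
    have contS: "continuous_on ({a..b} \<times> UNIV) (\<lambda>p. O1 p * O2 (?S p))"
      by (intro continuous_on_mult cont1 continuous_on_compose2[OF cont2 continuous_on_skew_map_power]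
          image_subsetI skew_map_in)
    have contT: "continuous_on ({a..b} \<times> UNIV) (\<lambda>p. O1 p * g (?T (snd p)))"
      by (intro continuous_on_mult cont1 continuous_on_compose2[OF g_cont[of UNIV]]
          continuous_on_compose2[OF continuous_on_matrix_power[of UNIV] continuous_on_snd] continuous_on_id) auto
    have fibre: "continuous_on UNIV (\<lambda>\<psi>. h (\<phi>, \<psi>))"
      if "continuous_on ({a..b} \<times> UNIV) h" "\<phi> \<in> {a..b}" for h :: "real \<times> (real^2) \<Rightarrow> real" and \<phi>
      using that(2) by (intro continuous_on_compose2[OF that(1)] continuous_intros) auto
    \<comment> \<open>Cost of replacing the orbit by the graph: a Lipschitz estimate in
      \<open>\<phi>\<close> over a fixed base point.\<close>
    have "\<bar>nu_0 a b (\<lambda>p. O1 p * O2 (?S p) - O1 p * g (?T (snd p)))\<bar> \<le> C * N1 * N2 * r ^ n"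
    proof (rule nu_0_fibre_bound[OF ab continuous_on_diff[OF contS contT]], rule abs_torus_mean_le)
      fix \<phi> assume \<phi>: "\<phi> \<in> {a..b}"
      show "continuous_on UNIV (\<lambda>\<psi>. O1 (\<phi>, \<psi>) * O2 (?S (\<phi>, \<psi>)) - O1 (\<phi>, \<psi>) * g (?T (snd (\<phi>, \<psi>))))"
        by (rule fibre[OF continuous_on_diff[OF contS contT] \<phi>])
      fix \<psi>
      have S: "?S (\<phi>, \<psi>) = (fst (?S (\<phi>, \<psi>)), ?T \<psi>)"
        using snd_skew_map_power[of n F A "(\<phi>, \<psi>)"] by (simp add: prod_eq_iff)
      have "fst (?S (\<phi>, \<psi>)) \<in> {a..b}"
        using skew_map_in[of "(\<phi>, \<psi>)" n] \<phi> by (auto simp: mem_Times_iff)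
      then have "\<bar>O2 (?S (\<phi>, \<psi>)) - g (?T \<psi>)\<bar> \<le> N2 * \<bar>fst (?S (\<phi>, \<psi>)) - W (?T \<psi>)\<bar>"
        using B_space_lipschitz[OF O(2) assms(14), of 0 "fst (?S (\<phi>, \<psi>))" "W (?T \<psi>)" "?T \<psi>"] W_in
        by (subst S) (simp add: g_def N2_def)
      also have "\<dots> \<le> N2 * (C * r ^ n)" using C(2)[OF \<phi>] N by (intro mult_left_mono) auto
      finally have "\<bar>O1 (\<phi>, \<psi>)\<bar> * \<bar>O2 (?S (\<phi>, \<psi>)) - g (?T \<psi>)\<bar> \<le> N1 * (N2 * (C * r ^ n))"
        using O1_bounds(1)[OF \<phi>] N by (intro mult_mono) auto
      then show "\<bar>O1 (\<phi>, \<psi>) * O2 (?S (\<phi>, \<psi>)) - O1 (\<phi>, \<psi>) * g (?T (snd (\<phi>, \<psi>)))\<bar> \<le> C * N1 * N2 * r ^ n"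
        by (simp add: right_diff_distrib[symmetric] abs_mult mult_ac)
    qed
    \<comment> \<open>With \<open>\<phi>\<close> frozen, \<open>O1\<close> is a Hoelder function on
      the torus, and \<open>K\<close> is the same on every fibre.\<close>
    moreover have "\<bar>nu_0 a b (\<lambda>p. O1 p * g (?T (snd p)) - O1 p * torus_mean g)\<bar>
        \<le> \<bar>K\<bar> * (N1 + N1 / \<alpha>s) * (N2 + N2 * (D + 1 / \<alpha>s)) * r ^ n"
    proof (rule nu_0_fibre_bound[OF ab])
      show "continuous_on ({a..b} \<times> UNIV) (\<lambda>p. O1 p * g (?T (snd p)) - O1 p * torus_mean g)"
        by (intro continuous_on_diff contT continuous_on_mult cont1 continuous_on_const)
      fix \<phi> assume \<phi>: "\<phi> \<in> {a..b}"
      let ?f = "\<lambda>\<psi>. O1 (\<phi>, \<psi>)"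
      have "torus_fun ?f" using O(1) \<phi> by (simp add: B_space_def)
      then have "\<bar>torus_mean (\<lambda>\<psi>. ?f \<psi> * g (?T \<psi>)) - torus_mean ?f * torus_mean g\<bar>
          \<le> K * (N1 + N1 / \<alpha>s) * (N2 + N2 * (D + 1 / \<alpha>s)) * r ^ n"
        using O1_bounds[OF \<phi>] O2_bound W_in N D(1) assms(14) g_holder
        by (intro K g_torus) (auto simp: g_def)
      also have "\<dots> \<le> \<bar>K\<bar> * (N1 + N1 / \<alpha>s) * (N2 + N2 * (D + 1 / \<alpha>s)) * r ^ n"
        using N D(1) assms(14) r0 by (intro mult_right_mono) auto
      finally show "\<bar>torus_mean (\<lambda>\<psi>. O1 (\<phi>, \<psi>) * g (?T (snd (\<phi>, \<psi>))) - O1 (\<phi>, \<psi>) * torus_mean g)\<bar>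
          \<le> \<bar>K\<bar> * (N1 + N1 / \<alpha>s) * (N2 + N2 * (D + 1 / \<alpha>s)) * r ^ n"
        using fibre[OF contT \<phi>] fibre[OF cont1 \<phi>]
        by (simp add: torus_mean_diff torus_mean_mult_right continuous_on_mult_right)
    qed
    moreover have "nu_0 a b (\<lambda>p. O1 p * O2 (?S p)) - nu_0 a b O1 * torus_mean g =
        nu_0 a b (\<lambda>p. O1 p * O2 (?S p) - O1 p * g (?T (snd p))) +
        nu_0 a b (\<lambda>p. O1 p * g (?T (snd p)) - O1 p * torus_mean g)"
      using contS contT cont1 by (simp add: nu_0_diff nu_0_mult_right continuous_on_mult_right)
    ultimately have "\<bar>nu_0 a b (\<lambda>p. O1 p * O2 (?S p)) - nu_0 a b O1 * torus_mean g\<bar>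
        \<le> C * N1 * N2 * r ^ n + \<bar>K\<bar> * (N1 + N1 / \<alpha>s) * (N2 + N2 * (D + 1 / \<alpha>s)) * r ^ n"
      by linarith
    also have "\<dots> = C1 * N1 * N2 * r ^ n"
    proof -
      have "N1 + N1 / \<alpha>s = N1 * (1 + 1 / \<alpha>s)" "N2 + N2 * (D + 1 / \<alpha>s) = N2 * (1 + (D + 1 / \<alpha>s))"
        by (simp_all add: distrib_left)
      moreover have "C * N1 * N2 * q + \<bar>K\<bar> * (N1 * x) * (N2 * y) * q = (C + \<bar>K\<bar> * x * y) * N1 * N2 * q"
        for q x y
        by (simp add: algebra_simps)
      ultimately show ?thesis unfolding C1_def by simp
    qed
    also have "\<dots> \<le> C1 * N1 * N2 * inverse ls ^ n"
      using C1 N r0 r(3) by (intro mult_left_mono power_mono) auto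
    finally show "\<bar>nu_0 a b (\<lambda>p. O1 p * O2 ((skew_map F A ^^ n) p)) - nu_0 a b O1 * nu_W W O2\<bar>
             \<le> C1 * enn2real (holder_norm {a..b} \<alpha>s O1)
                  * enn2real (B_norm {a..b} \<alpha>s 1 O2) * inverse ls ^ n"
      by (simp add: nu_W_def g_def[abs_def] N1_def N2_def)
  qed
qed

end
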